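(* Let $\Omega$ be a symmetric slice domain. The correspondence $$([T],f)\mapsto[T]^*f:=T^*f,\qquad [T]\in\Gamma_{\mathrm{univ}},\ f\in\mathrm{SR}(\Omega,\mathbb H),$$ is independent of the choice of a representative $T\in\mathcal B_{\mathbb H}$ of $[T]$, and it defines a faithful (left) action of the group $\Gamma_{\mathrm{univ}}$ on $\mathrm{SR}(\Omega,\mathbb H)$.
   Context: $\mathbb H$ denotes the quaternions and $\mathbb S=\{q\in\mathbb H: q^2=-1\}$. Fix $i,j\in\mathbb S$ with $ij=-ji$, and put $\mathbb C:=\mathbb R+\mathbb R i\subset\mathbb H$, $\mathbb C^+:=\{x+yi:y>0\}$. A symmetric slice domain is a domain $\Omega\subset\mathbb H$ with $\Omega\cap\mathbb R\ne\emptyset$, with $\Omega_I:=\Omega\cap(\mathbb R+\mathbb R I)$ a domain for all $I\in\mathbb S$, and such that $x+yI\in\Omega$ implies $x+yI'\in\Omega$ for all $I,I'\in\mathbb S$. Put $V:=\Omega\cap\mathbb C^+$. A function $f:\Omega\to\mathbb H$ is slice regular if for every $I\in\mathbb S$ the restriction $f|_{\Omega_I}$ satisfies $\frac12(\partial_x+I\partial_y)f(x+yI)=0$; $\mathrm{SR}(\Omega,\mathbb H)$ is the set of such functions. For $f\in\mathrm{SR}(\Omega,\mathbb H)$ write $f(z)=g(z)+h(z)j$ for $z\in\Omega_i$ with $g,h:\Omega_i\to\mathbb C$ holomorphic, put $\hat g(z)=\overline{g(\overline z)}$, $\hat h(z)=\overline{h(\overline z)}$, and $$\Phi_f(z)=\begin{pmatrix}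 g(z) & -\hat h(z) \\ h(z) & \hat g(z) \end{pmatrix}.$$ For $\Phi\in\mathrm{Mat}_{2\times2}(\mathbb C)$ let $L(\Phi)=\{(x,\Phi x):x\in\mathbb C^2\}\in\mathrm{Gr}_2(\mathbb C^4)$, and let $G_f:V\to\mathrm{Gr}_2(\mathbb C^4)$, $G_f(v)=L(\Phi_f(v))$, be the twistor transform of $f$. $\mathrm{GL}(2,\mathbb H)\subset\mathrm{GL}(4,\mathbb C)$ is the group of invertible block matrices $\begin{pmatrix} A & B \\ C & D \end{pmatrix}$ whose four $2\times2$ blocks have the form $\begin{pmatrix} z & -\overline w \\ w & \overline z \end{pmatrix}$, and $\mathrm{PGL}(2,\mathbb H)=\mathrm{GL}(2,\mathbb H)/\mathbb R^\times$. Let $\mathcal B_{\mathbb H}\subset\mathrm{GL}(2,\mathbb H)$ be the subgroup of those matrices with $B=0$, and $\Gamma_{\mathrm{univ}}:=\mathcal B_{\mathbb H}/\mathbb R^\times\subset\mathrm{PGL}(2,\mathbb H)$. For $T=\begin{pmatrix} A & 0 \\ C & D \end{pmatrix}\in\mathcal B_{\mathbb H}$ and $f\in\mathrm{SR}(\Omega,\mathbb H)$, $T^*f$ denotes the unique function in $\mathrm{SR}(\Omega,\mathbb H)$ with $G_{T^*f}=T\cdot G_f$, equivalently $\Phi_{T^*f}=(C+D\Phi_f)A^{-1}$. *)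

theory Defs
  imports "HOL-Analysis.Analysis" "HOL-Algebra.Group_Action"
begin

section \<open>Quaternions\<close>

text \<open>
  \<open>Quat a b c d\<close> is \<open>a + b e1 + c e2 + d e3\<close> for the standard basis with
  \<open>e1 * e2 = e3\<close>. This basis only serves to construct the division ring; the units \<open>i, j\<close> below are
  arbitrary anticommuting imaginary units.
\<close>

datatype quat = Quat (q0: real) (q1: real) (q2: real) (q3: real)

lemma quat_eq_iff: "x = y \<longleftrightarrow> q0 x = q0 y \<and> q1 x = q1 y \<and> q2 x = q2 y \<and> q3 x = q3 y"
  by (cases x; cases y) simp

instantiation quat :: ab_group_add
begin

definition "0 = Quat 0 0 0 0"
definition "x + y = Quat (q0 x + q0 y) (q1 x + q1 y) (q2 x + q2 y) (q3 x + q3 y)"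
definition "- x = Quat (- q0 x) (- q1 x) (- q2 x) (- q3 x)"
definition "x - y = Quat (q0 x - q0 y) (q1 x - q1 y) (q2 x - q2 y) (q3 x - q3 y)"

instance
  by standard (simp_all add: quat_eq_iff zero_quat_def plus_quat_def uminus_quat_def minus_quat_def)

end

lemma quat_add_sel [simp]:
  "q0 0 = 0" "q1 0 = 0" "q2 0 = 0" "q3 0 = 0"
  "q0 (x + y) = q0 x + q0 y" "q1 (x + y) = q1 x + q1 y"
  "q2 (x + y) = q2 x + q2 y" "q3 (x + y) = q3 x + q3 y"
  "q0 (- x) = - q0 x" "q1 (- x) = - q1 x" "q2 (- x) = - q2 x" "q3 (- x) = - q3 x"
  "q0 (x - y) = q0 x - q0 y" "q1 (x - y) = q1 x - q1 y"
  "q2 (x - y) = q2 x - q2 y" "q3 (x - y) = q3 x - q3 y"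
  by (simp_all add: zero_quat_def plus_quat_def uminus_quat_def minus_quat_def)

instantiation quat :: real_algebra_1
begin

definition "1 = Quat 1 0 0 0"
definition "x * y = Quat
  (q0 x * q0 y - q1 x * q1 y - q2 x * q2 y - q3 x * q3 y)
  (q0 x * q1 y + q1 x * q0 y + q2 x * q3 y - q3 x * q2 y)
  (q0 x * q2 y - q1 x * q3 y + q2 x * q0 y + q3 x * q1 y)
  (q0 x * q3 y + q1 x * q2 y - q2 x * q1 y + q3 x * q0 y)"
definition "r *\<^sub>R x = Quat (r * q0 x) (r * q1 x) (r * q2 x) (r * q3 x)"

instance
  by standard (simp_all add: quat_eq_iff one_quat_def times_quat_def scaleR_quat_def algebra_simps)

end

lemma quat_mult_sel [simp]:
  "q0 1 = 1" "q1 1 = 0" "q2 1 = 0" "q3 1 = 0"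
  "q0 (x * y) = q0 x * q0 y - q1 x * q1 y - q2 x * q2 y - q3 x * q3 y"
  "q1 (x * y) = q0 x * q1 y + q1 x * q0 y + q2 x * q3 y - q3 x * q2 y"
  "q2 (x * y) = q0 x * q2 y - q1 x * q3 y + q2 x * q0 y + q3 x * q1 y"
  "q3 (x * y) = q0 x * q3 y + q1 x * q2 y - q2 x * q1 y + q3 x * q0 y"
  "q0 (r *\<^sub>R x) = r * q0 x" "q1 (r *\<^sub>R x) = r * q1 x"
  "q2 (r *\<^sub>R x) = r * q2 x" "q3 (r *\<^sub>R x) = r * q3 x"
  by (simp_all add: one_quat_def times_quat_def scaleR_quat_def)

instantiation quat :: real_inner
begin

definition "inner x y = q0 x * q0 y + q1 x * q1 y + q2 x * q2 y + q3 x * q3 y" for x y :: quat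
definition "norm x = sqrt (inner x x)" for x :: quat
definition "sgn x = x /\<^sub>R norm x" for x :: quat
definition "dist x y = norm (x - y)" for x y :: quat
definition uniformity_quat_def:
  "(uniformity :: (quat \<times> quat) filter) = (INF e\<in>{0 <..}. principal {(x, y). dist x y < e})"
definition open_quat_def:
  "open (U :: quat set) \<longleftrightarrow> (\<forall>x\<in>U. eventually (\<lambda>(x', y). x' = x \<longrightarrow> y \<in> U) uniformity)"

instance
proof
  fix x y z :: quat and r :: real
  show "inner x x = 0 \<longleftrightarrow> x = 0"
  proof
    assume "inner x x = 0"
    then have "(q0 x)\<^sup>2 + (q1 x)\<^sup>2 + (q2 x)\<^sup>2 + (q3 x)\<^sup>2 = 0"
      by (simp add: inner_quat_def power2_eq_square)
    then show "x = 0"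
      by (simp add: quat_eq_iff add_nonneg_eq_0_iff)
  qed (simp add: inner_quat_def)
qed (simp_all add: inner_quat_def norm_quat_def sgn_quat_def dist_quat_def uniformity_quat_def
      open_quat_def algebra_simps)

end

instantiation quat :: real_normed_div_algebra
begin

definition "inverse x = Quat (q0 x) (- q1 x) (- q2 x) (- q3 x) /\<^sub>R inner x x" for x :: quat
definition "x div y = x * inverse y" for x y :: quat

instance
proof
  fix x y :: quat
  show "norm (x * y) = norm x * norm y"
    unfolding norm_quat_def real_sqrt_mult[symmetric]
    by (simp add: inner_quat_def algebra_simps)
  assume "x \<noteq> 0"
  then have "inner x x \<noteq> 0" by simp
  then have *: "inverse (inner x x) * inner x x = 1" by simp
  show "inverse x * x = 1" and "x * inverse x = 1"
    using * by (simp_all add: quat_eq_iff inverse_quat_def inner_quat_def algebra_simps)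
qed (simp_all add: quat_eq_iff inverse_quat_def divide_quat_def)

end

definition imag_units :: "quat set" where
  "imag_units = {q. q\<^sup>2 = -1}"

text \<open>
  For \<open>I\<close> an imaginary unit, \<open>slice_pt I\<close> is the isomorphism \<open>x + y\<i> \<mapsto> x + yI\<close> from the library's
  complex numbers onto \<open>\<real> + \<real>I\<close>. For \<open>I = i\<close> it is the identification of \<open>\<complex>\<close> with a subfield of
  the quaternions; sets and functions in \<open>\<real> + \<real>i\<close> are expressed on the type \<^typ>\<open>complex\<close> through it.
\<close>

definition slice_pt :: "quat \<Rightarrow> complex \<Rightarrow> quat" where
  "slice_pt I z = of_real (Re z) + of_real (Im z) * I"

section \<open>Slice regular functions\<close>

definition domain_in :: "'a::topological_space set \<Rightarrow> 'a set \<Rightarrow> bool" where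
  "domain_in X U \<longleftrightarrow> openin (top_of_set X) U \<and> connected U \<and> U \<noteq> {}"

definition symmetric_slice_domain :: "quat set \<Rightarrow> bool" where
  "symmetric_slice_domain \<Omega> \<longleftrightarrow>
     domain_in UNIV \<Omega> \<and>
     \<Omega> \<inter> range of_real \<noteq> {} \<and>
     (\<forall>I\<in>imag_units. domain_in (range (slice_pt I)) (\<Omega> \<inter> range (slice_pt I))) \<and>
     (\<forall>I\<in>imag_units. \<forall>I'\<in>imag_units. \<forall>z. slice_pt I z \<in> \<Omega> \<longrightarrow> slice_pt I' z \<in> \<Omega>)"

text \<open>
  In the slice \<open>\<real> + \<real>I\<close> with coordinate \<open>x + yI\<close>, the partial derivatives of \<open>f\<close> are the values
  \<open>D 1\<close> and \<open>D \<i>\<close> of the real derivative. The restriction to each slice is required to be real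
  (Frechet) differentiable, as usual for holomorphic functions; existence of the two partial
  derivatives alone would not do.
\<close>

definition slice_regular_on :: "quat set \<Rightarrow> (quat \<Rightarrow> quat) \<Rightarrow> bool" where
  "slice_regular_on \<Omega> f \<longleftrightarrow>
     (\<forall>I\<in>imag_units. \<forall>z. slice_pt I z \<in> \<Omega> \<longrightarrow>
        (\<exists>D. ((\<lambda>w. f (slice_pt I w)) has_derivative D) (at z) \<and>
             (1/2) *\<^sub>R (D 1 + I * D \<i>) = 0))"

text \<open>
  Functions \<open>\<Omega> \<rightarrow> \<H>\<close> are represented by functions that are \<^const>\<open>undefined\<close> outside \<open>\<Omega>\<close>, so that
  equality in \<open>SR \<Omega>\<close> is equality on \<open>\<Omega>\<close>.
\<close>

definition SR :: "quat set \<Rightarrow> (quat \<Rightarrow> quat) set" where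
  "SR \<Omega> = {f \<in> extensional \<Omega>. slice_regular_on \<Omega> f}"

section \<open>The twistor transform\<close>

text \<open>The decomposition \<open>q = a + b j\<close> with \<open>a, b \<in> \<real> + \<real>i\<close>.\<close>

definition quat_split :: "quat \<Rightarrow> quat \<Rightarrow> quat \<Rightarrow> complex \<times> complex" where
  "quat_split i j q = (THE (a, b). q = slice_pt i a + slice_pt i b * j)"

definition split_g :: "quat \<Rightarrow> quat \<Rightarrow> (quat \<Rightarrow> quat) \<Rightarrow> complex \<Rightarrow> complex" where
  "split_g i j f z = fst (quat_split i j (f (slice_pt i z)))"

definition split_h :: "quat \<Rightarrow> quat \<Rightarrow> (quat \<Rightarrow> quat) \<Rightarrow> complex \<Rightarrow> complex" where
  "split_h i j f z = snd (quat_split i j (f (slice_pt i z)))"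

definition hat :: "(complex \<Rightarrow> complex) \<Rightarrow> complex \<Rightarrow> complex" where
  "hat g z = cnj (g (cnj z))"

definition Phi :: "quat \<Rightarrow> quat \<Rightarrow> (quat \<Rightarrow> quat) \<Rightarrow> complex \<Rightarrow> complex^2^2" where
  "Phi i j f z =
     vector [vector [split_g i j f z, - hat (split_h i j f) z],
             vector [split_h i j f z,   hat (split_g i j f) z]]"

text \<open>
  \<open>\<complex>\<^sup>4\<close> is indexed by the sum type \<open>2 + 2\<close>, so that \<open>\<complex>\<^sup>4 = \<complex>\<^sup>2 \<oplus> \<complex>\<^sup>2\<close> and block matrices are
  immediate.
\<close>

definition pair_vec :: "complex^2 \<Rightarrow> complex^2 \<Rightarrow> complex^(2+2)" where
  "pair_vec x y = (\<chi> k. case k of Inl l \<Rightarrow> x $ l | Inr l \<Rightarrow> y $ l)"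

definition graph_space :: "complex^2^2 \<Rightarrow> (complex^(2+2)) set" where
  "graph_space M = {pair_vec x (M *v x) | x. True}"

definition upper_part :: "quat \<Rightarrow> quat set \<Rightarrow> complex set" where
  "upper_part i \<Omega> = {z. Im z > 0 \<and> slice_pt i z \<in> \<Omega>}"

text \<open>A point of the Grassmannian is represented by the subspace itself, as a set of vectors.\<close>

definition twistor_transform ::
  "quat \<Rightarrow> quat \<Rightarrow> quat set \<Rightarrow> (quat \<Rightarrow> quat) \<Rightarrow> complex \<Rightarrow> (complex^(2+2)) set" where
  "twistor_transform i j \<Omega> f = (\<lambda>v\<in>upper_part i \<Omega>. graph_space (Phi i j f v))"

section \<open>The groups\<close>

definition block_matrix ::
  "complex^2^2 \<Rightarrow> complex^2^2 \<Rightarrow> complex^2^2 \<Rightarrow> complex^2^2 \<Rightarrow> complex^(2+2)^(2+2)" where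
  "block_matrix A B C D = (\<chi> r c.
     case r of
       Inl k \<Rightarrow> (case c of Inl l \<Rightarrow> A $ k $ l | Inr l \<Rightarrow> B $ k $ l)
     | Inr k \<Rightarrow> (case c of Inl l \<Rightarrow> C $ k $ l | Inr l \<Rightarrow> D $ k $ l))"

definition quat_blocks :: "(complex^2^2) set" where
  "quat_blocks = {vector [vector [z, - cnj w], vector [w, cnj z]] | z w. True}"

definition GL2H :: "(complex^(2+2)^(2+2)) monoid" where
  "GL2H = \<lparr>carrier = {T. invertible T \<and>
              (\<exists>A\<in>quat_blocks. \<exists>B\<in>quat_blocks. \<exists>C\<in>quat_blocks. \<exists>D\<in>quat_blocks.
                 T = block_matrix A B C D)},
           mult = (**), one = mat 1\<rparr>"

definition real_scalars :: "(complex^(2+2)^(2+2)) set" where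
  "real_scalars = {mat (of_real r) | r::real. r \<noteq> 0}"

definition PGL2H :: "(complex^(2+2)^(2+2)) set monoid" where
  "PGL2H = GL2H Mod real_scalars"

definition proj_class :: "complex^(2+2)^(2+2) \<Rightarrow> (complex^(2+2)^(2+2)) set" where
  "proj_class T = real_scalars #>\<^bsub>GL2H\<^esub> T"

definition B_H :: "(complex^(2+2)^(2+2)) set" where
  "B_H = {T \<in> carrier GL2H.
            \<exists>A\<in>quat_blocks. \<exists>C\<in>quat_blocks. \<exists>D\<in>quat_blocks. T = block_matrix A 0 C D}"

definition Gamma_univ :: "(complex^(2+2)^(2+2)) set monoid" where
  "Gamma_univ = PGL2H\<lparr>carrier := proj_class ` B_H\<rparr>"

section \<open>The action\<close>

definition pullback ::
  "quat \<Rightarrow> quat \<Rightarrow> quat set \<Rightarrow> complex^(2+2)^(2+2) \<Rightarrow> (quat \<Rightarrow> quat) \<Rightarrow> (quat \<Rightarrow> quat)" where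
  "pullback i j \<Omega> T f = (THE F. F \<in> SR \<Omega> \<and>
     twistor_transform i j \<Omega> F =
       (\<lambda>v\<in>upper_part i \<Omega>. (\<lambda>x. T *v x) ` twistor_transform i j \<Omega> f v))"

text \<open>The common value of \<open>T\<^sup>*f\<close> for all representatives \<open>T\<close> of the class \<open>X\<close>.\<close>

definition class_pullback ::
  "quat \<Rightarrow> quat \<Rightarrow> quat set \<Rightarrow> (complex^(2+2)^(2+2)) set \<Rightarrow> (quat \<Rightarrow> quat) \<Rightarrow> (quat \<Rightarrow> quat)" where
  "class_pullback i j \<Omega> X f = the_elem ((\<lambda>T. pullback i j \<Omega> T f) ` X)"

end

theory Submission
  imports Defs "HOL-Complex_Analysis.Conformal_Mappings"
begin

text \<open>
  A function in \<open>SR \<Omega>\<close> is the same thing as a holomorphic stem: on every slice it has the form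
  \<open>f (x + yI) = F1 (x, y) + I F2 (x, y)\<close> with \<open>F1\<close>, \<open>F2\<close> independent of \<open>I\<close>, \<open>F1\<close> even and \<open>F2\<close> odd in
  \<open>y\<close>, and \<open>F1 + \<i> F2\<close> holomorphic with values in \<open>\<H> \<otimes> \<complex>\<close>. That such \<open>F1\<close>, \<open>F2\<close> exist is the
  representation formula (\<open>representation_formula\<close>); conversely every holomorphic stem induces a
  slice regular function (\<open>regular_of_holomorphic_stem\<close>).

  The assignment \<open>a + bj \<mapsto> (a, - cnj b; b, cnj a)\<close> is an isomorphism \<open>M\<close> of real vector spaces from
  \<open>\<H>\<close> onto the quaternionic \<open>2 \<times> 2\<close> blocks that reverses products, and its complexification is an
  isomorphism \<open>\<H> \<otimes> \<complex> \<rightarrow> Mat\<^sub>2(\<complex>)\<close>. The matrix \<open>\<Phi>\<^sub>f\<close> is just the image of the stem under it,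
  \<open>\<Phi>\<^sub>f = M F1 + \<i> M F2\<close> (\<open>Phi_eq_complex_qmat\<close>). Hence the twistor transform determines the stem
  on the upper half of \<open>\<Omega>\<close>, by parity and continuity everywhere, and so it determines \<open>f\<close>
  (\<open>twistor_transform_inject\<close>). Moreover, for a lower triangular \<open>T\<close> with blocks \<open>M a\<close>, \<open>M c\<close>, \<open>M d\<close>,
  the matrix \<open>(C + D \<Phi>\<^sub>f) A\<^sup>-\<^sup>1\<close> comes from the stem \<open>a\<^sup>-\<^sup>1 (c + F1 d)\<close>, \<open>a\<^sup>-\<^sup>1 F2 d\<close>, which is
  again holomorphic. Therefore \<open>T\<^sup>*f\<close> exists and is unique (\<open>pullback\<close>).

  Everything else is formal. Since \<open>T\<^sup>*f\<close> is characterized by \<open>G\<^bsub>T\<^sup>*f\<^esub> = T G\<^sub>f\<close>, and subspaces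
  absorb nonzero scalars, \<open>T\<^sup>*\<close> depends only on the class of \<open>T\<close>, and \<open>(S T)\<^sup>* = S\<^sup>* T\<^sup>*\<close>. If
  \<open>T\<^sup>*\<close> fixes every function, then it fixes the constants, so \<open>T\<close> fixes the graph of every
  quaternionic block \<open>N\<close>, that is \<open>C + D N = N A\<close>. Taking \<open>N = 0\<close> and \<open>N = 1\<close> gives \<open>C = 0\<close> and
  \<open>A = D\<close>, so \<open>A\<close> lies in the centre of \<open>\<H>\<close>, and \<open>T\<close> is a real scalar
  (\<open>graph_fixing_is_real_scalar\<close>).
\<close>

section \<open>Block matrices and graphs\<close>

lemma sum_two_plus_two:
  fixes f :: "2 + 2 \<Rightarrow> complex"
  shows "sum f UNIV = (f (Inl 1) + f (Inl 2)) + (f (Inr 1) + f (Inr 2))"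
proof -
  have "sum f UNIV = (\<Sum>k\<in>UNIV. f (Inl k)) + (\<Sum>k\<in>UNIV. f (Inr k))"
    by (simp add: UNIV_Plus_UNIV [symmetric] sum.Plus del: UNIV_Plus_UNIV)
  then show ?thesis
    by (simp add: sum_2)
qed

lemma forall_two_plus_two:
  "(\<forall>k::2+2. P k) \<longleftrightarrow> P (Inl 1) \<and> P (Inl 2) \<and> P (Inr 1) \<and> P (Inr 2)"
  by (simp only: split_sum_all forall_2 conj_assoc)

lemma two_by_two_eq_iff:
  fixes A B :: "complex^2^2"
  shows "A = B \<longleftrightarrow> A$1$1 = B$1$1 \<and> A$1$2 = B$1$2 \<and> A$2$1 = B$2$1 \<and> A$2$2 = B$2$2"
  by (auto simp: vec_eq_iff forall_2)

lemma mat_mult_left: "mat c ** T = (\<chi> r s. c * T $ r $ s)" for T :: "complex^'n^'n"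
  by (simp add: vec_eq_iff matrix_matrix_mult_def mat_def if_distrib if_distribR cong: if_cong)

lemma mat_commutes: "mat c ** T = T ** mat c" for T :: "complex^'n^'n"
  unfolding mat_mult_left
  by (simp add: vec_eq_iff matrix_matrix_mult_def mat_def if_distrib if_distribR cong: if_cong)

lemma mat_mult_mat: "mat c ** mat d = (mat (c * d) :: complex^'n^'n)"
  unfolding mat_mult_left by (simp add: vec_eq_iff mat_def)

lemma matrix_add_rdistrib: "(A + B) ** C = A ** C + B ** C" for A B C :: "complex^2^2"
  by (simp add: two_by_two_eq_iff matrix_matrix_mult_def sum_2 algebra_simps)

lemma block_matrix_entries [simp]:
  "block_matrix A B C D $ Inl k $ Inl l = A $ k $ l"
  "block_matrix A B C D $ Inl k $ Inr l = B $ k $ l"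
  "block_matrix A B C D $ Inr k $ Inl l = C $ k $ l"
  "block_matrix A B C D $ Inr k $ Inr l = D $ k $ l"
  by (simp_all add: block_matrix_def)

lemma pair_vec_entries [simp]:
  "pair_vec x y $ Inl k = x $ k" "pair_vec x y $ Inr k = y $ k"
  by (simp_all add: pair_vec_def)

lemma pair_vec_eq_iff: "pair_vec x y = pair_vec x' y' \<longleftrightarrow> x = x' \<and> y = y'"
  by (auto simp: vec_eq_iff forall_two_plus_two forall_2)

lemma block_matrix_eq_iff:
  "block_matrix A B C D = block_matrix A' B' C' D' \<longleftrightarrow> A = A' \<and> B = B' \<and> C = C' \<and> D = D'"
  by (auto simp: vec_eq_iff forall_two_plus_two forall_2)

lemma block_matrix_exhaust:
  obtains A B C D where "T = block_matrix A B C D"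
proof
  show "T = block_matrix (\<chi> k l. T $ Inl k $ Inl l) (\<chi> k l. T $ Inl k $ Inr l)
                         (\<chi> k l. T $ Inr k $ Inl l) (\<chi> k l. T $ Inr k $ Inr l)"
    by (auto simp: vec_eq_iff forall_two_plus_two forall_2)
qed

lemma block_matrix_mult:
  "block_matrix A B C D ** block_matrix A' B' C' D' =
   block_matrix (A ** A' + B ** C') (A ** B' + B ** D') (C ** A' + D ** C') (C ** B' + D ** D')"
  by (simp add: vec_eq_iff forall_two_plus_two forall_2 matrix_matrix_mult_def sum_two_plus_two sum_2)

lemma block_matrix_vector_mult:
  "block_matrix A B C D *v pair_vec x y = pair_vec (A *v x + B *v y) (C *v x + D *v y)"
  by (simp add: vec_eq_iff forall_two_plus_two forall_2 matrix_vector_mult_def sum_two_plus_two sum_2)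

lemma mat_eq_block_matrix: "mat c = block_matrix (mat c) 0 0 (mat c)"
  by (simp add: vec_eq_iff forall_two_plus_two forall_2 mat_def)

lemma graph_space_eq_iff: "graph_space M = graph_space N \<longleftrightarrow> M = N"
proof
  assume *: "graph_space M = graph_space N"
  have "M *v x = N *v x" for x
  proof -
    have "pair_vec x (M *v x) \<in> graph_space N"
      unfolding * [symmetric] by (auto simp: graph_space_def)
    then show ?thesis
      by (auto simp: graph_space_def pair_vec_eq_iff)
  qed
  then show "M = N"
    by (simp add: matrix_eq)
qed simp

text \<open>
  The vector \<open>(x, M x)\<close> goes to \<open>(A x, (C + D M) x) = (A x, N (A x))\<close>, and \<open>A x\<close> runs through all
  vectors.
\<close>

lemma image_graph_space:
  assumes "N ** A = C + D ** M" and "invertible A"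
  shows "(*v) (block_matrix A 0 C D) ` graph_space M = graph_space N"
proof -
  have T: "block_matrix A 0 C D *v pair_vec x (M *v x) = pair_vec (A *v x) (N *v (A *v x))" for x
    by (simp add: block_matrix_vector_mult pair_vec_eq_iff matrix_vector_mul_assoc assms(1)
        matrix_vector_mult_add_rdistrib)
  obtain A' where A': "A ** A' = mat 1"
    using assms(2) by (auto simp: invertible_def)
  have "x = A *v (A' *v x)" for x
    by (simp add: matrix_vector_mul_assoc A')
  then have "\<exists>y. x = A *v y" for x by blast
  then show ?thesis
    unfolding graph_space_def using T by (auto simp: image_def) (metis T)
qed

lemma scalar_image_graph_space:
  assumes "c \<noteq> 0"
  shows "(*v) (mat c :: complex^(2+2)^(2+2)) ` graph_space M = graph_space M"
proof -
  have "mat c ** mat (inverse c) = (mat 1 :: complex^2^2)"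
    using assms by (simp add: mat_mult_mat)
  then have "invertible (mat c :: complex^2^2)"
    by (auto simp: invertible_right_inverse)
  then show ?thesis
    unfolding mat_eq_block_matrix [of c] by (intro image_graph_space) (simp_all add: mat_commutes [of c M])
qed

section \<open>The quaternionic groups\<close>

definition cnj_matrix :: "complex^'n^'m \<Rightarrow> complex^'n^'m" where
  "cnj_matrix T = (\<chi> r c. cnj (T $ r $ c))"

lemma cnj_matrix_mult: "cnj_matrix (S ** T) = cnj_matrix S ** cnj_matrix T"
  by (simp add: cnj_matrix_def vec_eq_iff matrix_matrix_mult_def)

lemma cnj_matrix_one [simp]: "cnj_matrix (mat 1) = mat 1"
  by (simp add: cnj_matrix_def vec_eq_iff mat_def)

text \<open>
  On the quaternions with complex basis \<open>1, j\<close>, left multiplication by \<open>j\<close> is the conjugate linear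
  map \<open>x \<mapsto> J2 (cnj x)\<close>.
\<close>

definition J2 :: "complex^2^2" where
  "J2 = vector [vector [0, -1], vector [1, 0]]"

definition J4 :: "complex^(2+2)^(2+2)" where
  "J4 = block_matrix J2 0 0 J2"

text \<open>
  Quaternionic blocks are the complex matrices that commute with left multiplication by \<open>j\<close>. In this
  form, closure under products and inverses needs no computation with entries.
\<close>

lemma quat_blocks_iff: "M \<in> quat_blocks \<longleftrightarrow> M ** J2 = J2 ** cnj_matrix M"
proof -
  have "M ** J2 = J2 ** cnj_matrix M \<longleftrightarrow> M $ 1 $ 2 = - cnj (M $ 2 $ 1) \<and> M $ 2 $ 2 = cnj (M $ 1 $ 1)"
    by (auto simp: two_by_two_eq_iff matrix_matrix_mult_def sum_2 J2_def cnj_matrix_def)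
  also have "\<dots> \<longleftrightarrow> M \<in> quat_blocks"
    by (auto simp: quat_blocks_def two_by_two_eq_iff)
  finally show ?thesis by simp
qed

lemma zero_in_quat_blocks: "0 \<in> quat_blocks"
  by (simp add: quat_blocks_iff two_by_two_eq_iff matrix_matrix_mult_def cnj_matrix_def)

text \<open>
  The same description of quaternionic matrices in size four makes the group laws formal.
\<close>

lemma GL2H_carrier_iff: "T \<in> carrier GL2H \<longleftrightarrow> invertible T \<and> T ** J4 = J4 ** cnj_matrix T"
proof -
  obtain A B C D where T: "T = block_matrix A B C D"
    by (rule block_matrix_exhaust)
  have "cnj_matrix T = block_matrix (cnj_matrix A) (cnj_matrix B) (cnj_matrix C) (cnj_matrix D)"
    by (simp add: T cnj_matrix_def vec_eq_iff forall_two_plus_two)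
  then have "T ** J4 = J4 ** cnj_matrix T \<longleftrightarrow>
      A \<in> quat_blocks \<and> B \<in> quat_blocks \<and> C \<in> quat_blocks \<and> D \<in> quat_blocks"
    by (simp add: T J4_def block_matrix_mult block_matrix_eq_iff quat_blocks_iff)
  then show ?thesis
    by (auto simp: GL2H_def T block_matrix_eq_iff)
qed

lemma GL2H_simps [simp]:
  "S \<otimes>\<^bsub>GL2H\<^esub> T = S ** T" "\<one>\<^bsub>GL2H\<^esub> = mat 1"
  by (simp_all add: GL2H_def)

lemma group_GL2H: "group GL2H"
proof (rule groupI)
  fix S T assume "S \<in> carrier GL2H" "T \<in> carrier GL2H"
  then show "S \<otimes>\<^bsub>GL2H\<^esub> T \<in> carrier GL2H"
    unfolding GL2H_carrier_iff GL2H_simps cnj_matrix_mult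
    by (metis invertible_mult matrix_mul_assoc)
next
  show "\<one>\<^bsub>GL2H\<^esub> \<in> carrier GL2H"
    by (auto simp: GL2H_carrier_iff invertible_def)
next
  fix T assume T: "T \<in> carrier GL2H"
  then obtain S where S: "T ** S = mat 1" "S ** T = mat 1"
    by (auto simp: GL2H_carrier_iff invertible_def)
  have "cnj_matrix T ** cnj_matrix S = mat 1"
    unfolding cnj_matrix_mult [symmetric] S by simp
  then have "S ** J4 = S ** (J4 ** cnj_matrix T) ** cnj_matrix S"
    by (metis matrix_mul_assoc matrix_mul_rid)
  also have "\<dots> = S ** (T ** J4) ** cnj_matrix S"
    using T by (simp add: GL2H_carrier_iff)
  also have "\<dots> = J4 ** cnj_matrix S"
    by (simp add: matrix_mul_assoc S)
  finally have "S \<in> carrier GL2H"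
    using S by (auto simp: GL2H_carrier_iff invertible_def)
  with S show "\<exists>S\<in>carrier GL2H. S \<otimes>\<^bsub>GL2H\<^esub> T = \<one>\<^bsub>GL2H\<^esub>"
    by auto
qed (simp_all add: matrix_mul_assoc)

lemma B_H_iff:
  "T \<in> B_H \<longleftrightarrow> invertible T \<and>
     (\<exists>A\<in>quat_blocks. \<exists>C\<in>quat_blocks. \<exists>D\<in>quat_blocks. T = block_matrix A 0 C D)"
  using zero_in_quat_blocks by (auto simp: B_H_def GL2H_def)

text \<open>
  The upper left block of a right inverse of \<open>T\<close> is a right inverse of \<open>A\<close>.
\<close>

lemma invertible_upper_left_block:
  assumes "invertible (block_matrix A 0 C D)"
  shows "invertible A"
proof -
  obtain S where S: "block_matrix A 0 C D ** S = mat 1"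
    using assms by (auto simp: invertible_def)
  obtain A' B' C' D' where "S = block_matrix A' B' C' D'"
    by (rule block_matrix_exhaust)
  with S have "A ** A' = mat 1"
    by (simp add: block_matrix_mult mat_eq_block_matrix block_matrix_eq_iff)
  then show ?thesis
    by (auto simp: invertible_right_inverse)
qed

text \<open>
  If \<open>B'\<close> is the upper right block of \<open>T\<^sup>-\<^sup>1\<close>, then \<open>T T\<^sup>-\<^sup>1 = 1\<close> gives \<open>A B' = 0\<close>, and \<open>A\<close> is
  invertible.
\<close>

lemma subgroup_B_H: "subgroup B_H GL2H"
proof (rule group.subgroupI [OF group_GL2H])
  show "B_H \<subseteq> carrier GL2H"
    by (auto simp: B_H_def)
  have "(mat 1 :: complex^2^2) \<in> quat_blocks"
    by (simp add: quat_blocks_iff)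
  moreover have "invertible (mat 1 :: complex^(2+2)^(2+2))"
    unfolding invertible_def by (rule exI [of _ "mat 1"]) simp
  ultimately have "mat 1 \<in> B_H"
    unfolding B_H_iff using mat_eq_block_matrix [of 1] zero_in_quat_blocks by blast
  then show "B_H \<noteq> {}" by auto
next
  fix T assume T: "T \<in> B_H"
  let ?S = "inv\<^bsub>GL2H\<^esub> T"
  have TG: "T \<in> carrier GL2H" using T by (simp add: B_H_def)
  obtain A C D where T_eq: "T = block_matrix A 0 C D"
    using T by (auto simp: B_H_def)
  have S: "?S \<in> carrier GL2H" "T ** ?S = mat 1"
    using group.inv_closed [OF group_GL2H TG] group.r_inv [OF group_GL2H TG] by simp_all
  then obtain A' B' C' D' where S_eq: "?S = block_matrix A' B' C' D'"
    and q: "A' \<in> quat_blocks" "C' \<in> quat_blocks" "D' \<in> quat_blocks"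
    by (auto simp: GL2H_def)
  have AB: "A ** B' = 0"
    using S(2) unfolding S_eq
    by (simp add: T_eq block_matrix_mult mat_eq_block_matrix block_matrix_eq_iff)
  obtain A'' where "A'' ** A = mat 1"
    using T invertible_upper_left_block [of A C D] by (auto simp add: B_H_iff simp flip: T_eq simp: invertible_def)
  then have "B' = A'' ** (A ** B')"
    by (simp add: matrix_mul_assoc)
  then have "B' = 0"
    by (simp add: AB)
  with S_eq q S(1) show "?S \<in> B_H"
    by (auto simp: B_H_def)
next
  fix S T assume "S \<in> B_H" "T \<in> B_H"
  moreover from this have "S \<otimes>\<^bsub>GL2H\<^esub> T \<in> carrier GL2H"
    using monoid.m_closed [OF group.is_monoid [OF group_GL2H], of S T] by (simp add: B_H_def)
  then obtain A' B' C' D' where "S ** T = block_matrix A' B' C' D'"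
    "A' \<in> quat_blocks" "C' \<in> quat_blocks" "D' \<in> quat_blocks" by (auto simp: GL2H_def)
  moreover have "invertible (S ** T)"
    using \<open>S \<in> B_H\<close> \<open>T \<in> B_H\<close> by (simp add: B_H_iff invertible_mult)
  ultimately show "S \<otimes>\<^bsub>GL2H\<^esub> T \<in> B_H"
    by (auto simp: B_H_iff block_matrix_mult block_matrix_eq_iff)
qed

lemma normal_real_scalars: "real_scalars \<lhd> GL2H"
proof (rule group.normalI [OF group_GL2H])
  have scalar: "mat (of_real r) \<in> carrier GL2H" if "r \<noteq> 0" for r :: real
  proof -
    have "mat (of_real r) ** mat (of_real (1/r)) = (mat 1 :: complex^(2+2)^(2+2))"
      using that by (simp add: mat_mult_mat)
    moreover have "cnj_matrix (mat (of_real r)) = (mat (of_real r) :: complex^(2+2)^(2+2))"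
      by (simp add: vec_eq_iff cnj_matrix_def mat_def)
    ultimately show ?thesis
      unfolding GL2H_carrier_iff invertible_right_inverse using mat_commutes [of _ J4] by auto
  qed
  show "subgroup real_scalars GL2H"
  proof (rule group.subgroupI [OF group_GL2H])
    show "real_scalars \<subseteq> carrier GL2H"
      using scalar by (auto simp: real_scalars_def)
    show "real_scalars \<noteq> {}"
      by (auto simp: real_scalars_def intro: exI [of _ 1])
    show "S \<otimes>\<^bsub>GL2H\<^esub> T \<in> real_scalars" if "S \<in> real_scalars" "T \<in> real_scalars" for S T
      using that by (auto simp: real_scalars_def mat_mult_mat simp flip: of_real_mult)
    show "inv\<^bsub>GL2H\<^esub> T \<in> real_scalars" if T: "T \<in> real_scalars" for T
    proof -
      obtain r where r: "r \<noteq> 0" "T = mat (of_real r)"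
        using T by (auto simp: real_scalars_def)
      then have "inv\<^bsub>GL2H\<^esub> T = mat (of_real (1/r))"
        by (intro group.inv_equality [OF group_GL2H]) (use scalar [of r] scalar [of "1/r"] in \<open>simp_all add: mat_mult_mat\<close>)
      with r show ?thesis
        by (auto simp: real_scalars_def intro!: exI [of _ "1/r"])
    qed
  qed
  show "\<forall>T\<in>carrier GL2H. real_scalars #>\<^bsub>GL2H\<^esub> T = T <#\<^bsub>GL2H\<^esub> real_scalars"
  proof
    fix T
    have "S ** T = T ** S" if "S \<in> real_scalars" for S
      using that mat_commutes [of _ T] by (auto simp: real_scalars_def)
    then show "real_scalars #>\<^bsub>GL2H\<^esub> T = T <#\<^bsub>GL2H\<^esub> real_scalars"
      unfolding r_coset_def l_coset_def GL2H_simps by (intro SUP_cong refl) blast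
  qed
qed

lemma group_hom_proj_class: "group_hom GL2H PGL2H proj_class"
  using group_GL2H normal.factorgroup_is_group [OF normal_real_scalars]
    normal.r_coset_hom_Mod [OF normal_real_scalars]
  by (simp add: group_hom_def group_hom_axioms_def PGL2H_def proj_class_def [abs_def])

lemma mem_proj_class_iff:
  "S \<in> proj_class T \<longleftrightarrow> (\<exists>r::real. r \<noteq> 0 \<and> S = mat (of_real r) ** T)"
  by (auto simp: proj_class_def r_coset_def real_scalars_def)

lemma proj_class_self: "T \<in> proj_class T"
  unfolding mem_proj_class_iff by (intro exI [of _ 1]) simp

lemma real_scalars_subset_B_H: "real_scalars \<subseteq> B_H"
proof
  fix S assume S: "S \<in> real_scalars"
  then obtain r :: real where r: "S = mat (of_real r)"
    by (auto simp: real_scalars_def)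
  have "S \<in> carrier GL2H"
    using normal_real_scalars S by (auto simp: normal_def dest: subgroup.mem_carrier)
  moreover have "(mat (of_real r) :: complex^2^2) \<in> quat_blocks"
    by (simp add: quat_blocks_iff two_by_two_eq_iff matrix_matrix_mult_def sum_2 J2_def cnj_matrix_def mat_def)
  ultimately show "S \<in> B_H"
    unfolding B_H_def r mat_eq_block_matrix [of "of_real r"] using zero_in_quat_blocks by blast
qed

text \<open>
  The centre of the quaternions is real: commuting with the block of \<open>i\<close> forces \<open>w = 0\<close>, and
  commuting with the block of \<open>j\<close> forces \<open>z\<close> to be real.
\<close>

lemma quat_blocks_center:
  assumes "A \<in> quat_blocks" and "\<And>M. M \<in> quat_blocks \<Longrightarrow> A ** M = M ** A"
  shows "\<exists>r::real. A = mat (of_real r)"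
proof -
  obtain z w where A: "A = vector [vector [z, - cnj w], vector [w, cnj z]]"
    using assms(1) by (auto simp: quat_blocks_def)
  have "vector [vector [\<i>, 0], vector [0, - \<i>]] \<in> quat_blocks"
    unfolding quat_blocks_def by (rule CollectI, rule exI [of _ \<i>], rule exI [of _ 0]) simp
  from assms(2) [OF this] have "w = 0"
    by (auto simp: A two_by_two_eq_iff matrix_matrix_mult_def sum_2)
  have "vector [vector [0, - 1], vector [1, 0]] \<in> quat_blocks"
    unfolding quat_blocks_def by (rule CollectI, rule exI [of _ 0], rule exI [of _ 1]) simp
  from assms(2) [OF this] have "cnj z = z"
    by (auto simp: A two_by_two_eq_iff matrix_matrix_mult_def sum_2)
  then have "A = mat (of_real (Re z))"
    using \<open>w = 0\<close> by (auto simp: A two_by_two_eq_iff mat_def complex_eq_iff)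
  then show ?thesis ..
qed

text \<open>
  The graph of \<open>M\<close> is fixed exactly if \<open>C + D M = M A\<close>. The choices \<open>M = 0\<close> and \<open>M = 1\<close> give \<open>C = 0\<close>
  and \<open>A = D\<close>, and the equation then says that \<open>A\<close> is central.
\<close>

lemma graph_fixing_is_real_scalar:
  assumes T: "T \<in> B_H"
    and fixed_graph: "\<And>M. M \<in> quat_blocks \<Longrightarrow> (*v) T ` graph_space M = graph_space M"
  shows "T \<in> real_scalars"
proof -
  obtain A C D where "A \<in> quat_blocks" and T_eq: "T = block_matrix A 0 C D" and "invertible T"
    using T by (auto simp: B_H_iff)
  have eq: "M ** A = C + D ** M" if "M \<in> quat_blocks" for M
    unfolding matrix_eq
  proof
    fix x
    have "pair_vec x (M *v x) \<in> graph_space M"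
      by (auto simp: graph_space_def)
    then have "T *v pair_vec x (M *v x) \<in> graph_space M"
      using fixed_graph [OF that] by blast
    then show "(M ** A) *v x = (C + D ** M) *v x"
      by (simp add: graph_space_def T_eq block_matrix_vector_mult pair_vec_eq_iff
          matrix_vector_mul_assoc matrix_vector_mult_add_rdistrib)
  qed
  have "C = 0"
    using eq [OF zero_in_quat_blocks] by simp
  moreover have "A = D"
    using eq [of "mat 1"] \<open>C = 0\<close> by (simp add: quat_blocks_iff)
  ultimately obtain r :: real where "A = mat (of_real r)"
    using eq quat_blocks_center [OF \<open>A \<in> quat_blocks\<close>] by auto
  then have T_eq: "T = mat (of_real r)"
    using \<open>C = 0\<close> \<open>A = D\<close> T_eq mat_eq_block_matrix [of "of_real r"] by simp
  moreover have "r \<noteq> 0"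
  proof
    assume "r = 0"
    then have "T = 0"
      by (simp add: T_eq vec_eq_iff mat_def)
    with \<open>invertible T\<close> obtain S where "0 ** S = (mat 1 :: complex^(2+2)^(2+2))"
      by (auto simp: invertible_def)
    then show False
      by (simp add: vec_eq_iff mat_def forall_two_plus_two)
  qed
  ultimately show ?thesis
    by (auto simp: real_scalars_def)
qed

section \<open>Slices of the quaternions\<close>

lemma of_real_quat_sel [simp]:
  "q0 (of_real r) = r" "q1 (of_real r) = 0" "q2 (of_real r) = 0" "q3 (of_real r) = 0"
  by (simp_all add: of_real_def)

lemma imag_units_iff:
  "I \<in> imag_units \<longleftrightarrow> q0 I = 0 \<and> inner I I = 1"
proof
  assume "I \<in> imag_units"
  then have eq: "I * I = - 1"
    by (simp add: imag_units_def power2_eq_square)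
  have "q0 I * q1 I = 0" "q0 I * q2 I = 0" "q0 I * q3 I = 0"
    and sq: "q0 I * q0 I - q1 I * q1 I - q2 I * q2 I - q3 I * q3 I = - 1"
    using arg_cong [OF eq, of q0] arg_cong [OF eq, of q1] arg_cong [OF eq, of q2] arg_cong [OF eq, of q3]
    by auto
  moreover have "\<not> (q1 I = 0 \<and> q2 I = 0 \<and> q3 I = 0)"
    proof
    assume "q1 I = 0 \<and> q2 I = 0 \<and> q3 I = 0"
    then have "q0 I * q0 I = - 1"
      using sq by simp
    then show False
      using zero_le_square [of "q0 I"] by linarith
  qed
  ultimately show "q0 I = 0 \<and> inner I I = 1"
    by (auto simp: inner_quat_def)
next
  assume "q0 I = 0 \<and> inner I I = 1"
  then show "I \<in> imag_units"
    by (auto simp add: imag_units_def power2_eq_square quat_eq_iff inner_quat_def)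
qed

lemma imag_unit_square: "I \<in> imag_units \<Longrightarrow> I * I = - 1"
  by (simp add: imag_units_def power2_eq_square)

lemma imag_unit_square_left: "I \<in> imag_units \<Longrightarrow> I * (I * q) = - q"
  by (simp add: imag_unit_square flip: mult.assoc)

lemma minus_imag_unit: "I \<in> imag_units \<Longrightarrow> - I \<in> imag_units"
  by (simp add: imag_units_def)

lemma slice_pt_scaleR: "slice_pt I z = Re z *\<^sub>R 1 + Im z *\<^sub>R I"
  by (simp add: slice_pt_def of_real_def)

lemma slice_pt_simps [simp]:
  "slice_pt I 0 = 0" "slice_pt I 1 = 1" "slice_pt I (of_real r) = of_real r" "slice_pt I \<i> = I"
  "slice_pt I (z + w) = slice_pt I z + slice_pt I w" "slice_pt I (- z) = - slice_pt I z"
  "slice_pt I (z - w) = slice_pt I z - slice_pt I w"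
  by (simp_all add: slice_pt_def algebra_simps)

lemma slice_pt_mult: "I \<in> imag_units \<Longrightarrow> slice_pt I (z * w) = slice_pt I z * slice_pt I w"
  by (simp add: slice_pt_scaleR algebra_simps imag_unit_square)

lemma slice_pt_cnj: "slice_pt I (cnj z) = slice_pt (- I) z"
  by (simp add: slice_pt_scaleR)

lemma bounded_linear_slice_pt: "bounded_linear (slice_pt I)"
  unfolding slice_pt_scaleR [abs_def]
  by (intro bounded_linear_add bounded_linear_scaleR_left [THEN bounded_linear_compose]
      bounded_linear_Re bounded_linear_Im)

lemma continuous_slice_pt [continuous_intros]: "continuous_on A (slice_pt I)"
  by (rule linear_continuous_on [OF bounded_linear_slice_pt])

text \<open>
  Commuting with \<open>I\<close> means that the vector part of \<open>p\<close> has zero cross product with the unit vector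
  \<open>I\<close>, so it is the multiple \<open>inner p I\<close> of \<open>I\<close>.
\<close>

lemma slice_pt_commutant:
  assumes "I \<in> imag_units" and "I * p = p * I"
  shows "p = slice_pt I (Complex (q0 p) (inner p I))"
proof -
  have I: "q0 I = 0" "q1 I * q1 I + q2 I * q2 I + q3 I * q3 I = 1"
    using assms(1) by (auto simp add: imag_units_iff inner_quat_def)
  have c: "q2 I * q3 p = q3 I * q2 p" "q3 I * q1 p = q1 I * q3 p" "q1 I * q2 p = q2 I * q1 p"
    using arg_cong [OF assms(2), of q1] arg_cong [OF assms(2), of q2] arg_cong [OF assms(2), of q3]
    by (simp_all add: I algebra_simps)
  have "q1 p = (q1 p * q1 I + q2 p * q2 I + q3 p * q3 I) * q1 I"
       "q2 p = (q1 p * q1 I + q2 p * q2 I + q3 p * q3 I) * q2 I"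
       "q3 p = (q1 p * q1 I + q2 p * q2 I + q3 p * q3 I) * q3 I"
    using I(2) c by algebra+
  then show ?thesis
    by (simp add: quat_eq_iff slice_pt_def inner_quat_def I)
qed

lemma slice_pt_exhaust:
  assumes "i \<in> imag_units"
  obtains I z where "I \<in> imag_units" "q = slice_pt I z"
proof (cases "q = of_real (q0 q)")
  case True
  then have "q = slice_pt i (of_real (q0 q))" by simp
  with assms that show thesis by blast
next
  case False
  define v where "v = q - of_real (q0 q)"
  have "v \<noteq> 0" "q0 v = 0"
    using False by (simp_all add: v_def)
  then have "v /\<^sub>R norm v \<in> imag_units"
    by (simp add: imag_units_iff power2_norm_eq_inner [symmetric] power2_eq_square)
  moreover have "q = slice_pt (v /\<^sub>R norm v) (Complex (q0 q) (norm v))"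
    using \<open>v \<noteq> 0\<close> by (simp add: slice_pt_scaleR of_real_def [symmetric]) (simp add: v_def)
  ultimately show thesis
    using that by blast
qed

section \<open>Quaternions as complex matrices\<close>

locale anticommuting_units =
  fixes i j :: quat
  assumes i: "i \<in> imag_units" and j: "j \<in> imag_units" and ij: "i * j = - (j * i)"
begin

lemma j_slice_pt: "j * slice_pt i z = slice_pt i (cnj z) * j"
  using ij by (simp add: slice_pt_scaleR algebra_simps)

text \<open>
  Conjugation by \<open>i\<close> splits \<open>q\<close> into a part that commutes with \<open>i\<close> and a part that anticommutes with
  \<open>i\<close>. The latter times \<open>j\<close> commutes with \<open>i\<close>, and the commutant of \<open>i\<close> is the slice of \<open>i\<close>.
\<close>

lemma quat_split_exists: "\<exists>a b. q = slice_pt i a + slice_pt i b * j"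
proof -
  let ?p = "(1/2) *\<^sub>R (q - i * q * i)"
  let ?r = "- ((1/2) *\<^sub>R (q + i * q * i)) * j"
  have ji: "j * i = - (i * j)" using ij by simp
  have "i * ?p = ?p * i"
    using imag_unit_square [OF i] by (simp add: algebra_simps imag_unit_square_left [OF i])
  then obtain a where a: "?p = slice_pt i a"
    using slice_pt_commutant [OF i] by blast
  have "i * ?r = ?r * i"
    using imag_unit_square [OF i] by (simp add: algebra_simps imag_unit_square_left [OF i] ji)
  then obtain b where b: "?r = slice_pt i b"
    using slice_pt_commutant [OF i] by blast
  have "?r * j = (1/2) *\<^sub>R (q + i * q * i)"
    by (simp add: mult.assoc imag_unit_square [OF j] del: mult_scaleR_left)
  then have "q = slice_pt i a + slice_pt i b * j"
    unfolding a [symmetric] b [symmetric] by (simp add: algebra_simps flip: scaleR_left.add)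
  then show ?thesis by blast
qed

text \<open>
  Multiplying by \<open>slice_pt i (cnj z)\<close> gives the real number \<open>cnj z * z\<close>, the squared modulus of \<open>z\<close>.
\<close>

lemma slice_pt_eq_0_iff [simp]: "slice_pt i z = 0 \<longleftrightarrow> z = 0"
proof
  assume "slice_pt i z = 0"
  then have "slice_pt i (cnj z * z) = 0"
    by (simp add: slice_pt_mult [OF i])
  then show "z = 0"
    by (simp add: complex_eq_iff mult.commute [of "cnj z"] complex_mult_cnj flip: of_real_power of_real_add)
qed simp

text \<open>
  The map \<open>q \<mapsto> - i q i\<close> fixes the first summand and changes the sign of the second one, so both
  vanish if their sum does.
\<close>

lemma split_eq_0_iff: "slice_pt i a + slice_pt i b * j = 0 \<longleftrightarrow> a = 0 \<and> b = 0"
proof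
  assume 0: "slice_pt i a + slice_pt i b * j = 0"
  have "slice_pt i a - slice_pt i b * j = - (i * (slice_pt i a + slice_pt i b * j) * i)"
  proof -
    have comm: "i * slice_pt i c = slice_pt i c * i" for c
      by (simp add: slice_pt_scaleR algebra_simps)
    have "i * slice_pt i a * i = - slice_pt i a"
      by (simp add: comm mult.assoc imag_unit_square [OF i])
    moreover have "i * (slice_pt i b * j) * i = slice_pt i b * j"
    proof -
      have "i * (slice_pt i b * j) * i = slice_pt i b * (i * j * i)"
        by (simp add: comm flip: mult.assoc)
      also have "i * j * i = j"
        by (simp add: ij mult.assoc imag_unit_square [OF i])
      finally show ?thesis .
    qed
    ultimately show ?thesis
      by (simp add: algebra_simps)
  qed
  then have "slice_pt i a = slice_pt i b * j"
    using 0 by simp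
  then have "2 *\<^sub>R slice_pt i a = 0"
    using 0 by (simp add: scaleR_2)
  then have "a = 0" by simp
  moreover have "j \<noteq> 0"
    using imag_unit_square [OF j] by auto
  ultimately show "a = 0 \<and> b = 0"
    using 0 by simp
qed simp

lemma quat_split_eq [simp]: "quat_split i j (slice_pt i a + slice_pt i b * j) = (a, b)"
  unfolding quat_split_def
proof (rule the_equality)
  fix y assume "case y of (c, d) \<Rightarrow> slice_pt i a + slice_pt i b * j = slice_pt i c + slice_pt i d * j"
  then obtain c d where y: "y = (c, d)"
    and eq: "slice_pt i a + slice_pt i b * j = slice_pt i c + slice_pt i d * j"
    by (cases y) auto
  have "slice_pt i (a - c) + slice_pt i (b - d) * j = 0"
    using eq by (simp add: algebra_simps)
  then show "y = (a, b)"
    by (simp only: split_eq_0_iff) (simp add: y)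
qed simp

text \<open>
  The matrix of right multiplication by \<open>q\<close> on the quaternions as a left vector space over the slice
  of \<open>i\<close> with basis \<open>1, j\<close>; being a right multiplication, it reverses products.
\<close>

definition qmat :: "quat \<Rightarrow> complex^2^2" where
  "qmat q = (case quat_split i j q of (a, b) \<Rightarrow> vector [vector [a, - cnj b], vector [b, cnj a]])"

lemma qmat_eq: "qmat (slice_pt i a + slice_pt i b * j) = vector [vector [a, - cnj b], vector [b, cnj a]]"
  by (simp add: qmat_def)

lemma qmat_add: "qmat (p + q) = qmat p + qmat q"
proof -
  obtain a b c d where pq: "p = slice_pt i a + slice_pt i b * j" "q = slice_pt i c + slice_pt i d * j"
    using quat_split_exists by blast
  then have "p + q = slice_pt i (a + c) + slice_pt i (b + d) * j"
    by (simp add: algebra_simps)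
  then show ?thesis
    by (simp only: qmat_eq) (simp add: pq qmat_eq two_by_two_eq_iff)
qed

lemma qmat_mult: "qmat (p * q) = qmat q ** qmat p"
proof -
  obtain a b c d where pq: "p = slice_pt i a + slice_pt i b * j" "q = slice_pt i c + slice_pt i d * j"
    using quat_split_exists by blast
  have "p * q = slice_pt i a * slice_pt i c + slice_pt i a * slice_pt i d * j
        + slice_pt i b * (j * slice_pt i c) + slice_pt i b * (j * slice_pt i d) * j"
    by (simp add: pq algebra_simps)
  also have "\<dots> = slice_pt i (a * c - b * cnj d) + slice_pt i (a * d + b * cnj c) * j"
    by (simp add: j_slice_pt slice_pt_mult [OF i] algebra_simps imag_unit_square [OF j])
  finally show ?thesis
    by (simp only: qmat_eq) (simp add: pq qmat_eq two_by_two_eq_iff matrix_matrix_mult_def sum_2 algebra_simps)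
qed

lemma qmat_1 [simp]: "qmat 1 = mat 1"
  using qmat_eq [of 1 0] by (simp add: two_by_two_eq_iff mat_def)

lemma range_qmat: "range qmat = quat_blocks"
proof
  show "range qmat \<subseteq> quat_blocks"
    by (auto simp: qmat_def quat_blocks_def split: prod.split) metis
  show "quat_blocks \<subseteq> range qmat"
    by (auto simp: quat_blocks_def qmat_eq [symmetric])
qed

text \<open>
  The value of the complexification of \<^const>\<open>qmat\<close> at \<open>p + \<i> q\<close>.
\<close>

definition complex_qmat :: "quat \<Rightarrow> quat \<Rightarrow> complex^2^2" where
  "complex_qmat p q = qmat p + mat \<i> ** qmat q"

lemma complex_qmat_eq:
  "complex_qmat (slice_pt i a + slice_pt i b * j) (slice_pt i c + slice_pt i d * j) =
   vector [vector [a + \<i> * c, - cnj b - \<i> * cnj d], vector [b + \<i> * d, cnj a + \<i> * cnj c]]"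
  by (simp add: complex_qmat_def qmat_eq two_by_two_eq_iff mat_mult_left)

text \<open>
  The first column consists of \<open>a + \<i> c\<close> and \<open>b + \<i> d\<close>, and the second one, up to order and sign, of
  the conjugates of \<open>a - \<i> c\<close> and \<open>b - \<i> d\<close>. Together they determine all four numbers.
\<close>

lemma complex_qmat_inject:
  assumes "complex_qmat p q = complex_qmat p' q'"
  shows "p = p' \<and> q = q'"
proof -
  obtain a b c d a' b' c' d' where pq:
    "p = slice_pt i a + slice_pt i b * j" "q = slice_pt i c + slice_pt i d * j"
    "p' = slice_pt i a' + slice_pt i b' * j" "q' = slice_pt i c' + slice_pt i d' * j"
    using quat_split_exists by metis
  have 1: "a + \<i> * c = a' + \<i> * c'" "b + \<i> * d = b' + \<i> * d'"
    and 2: "cnj a + \<i> * cnj c = cnj a' + \<i> * cnj c'" "cnj b + \<i> * cnj d = cnj b' + \<i> * cnj d'"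
    using assms by (simp_all add: pq complex_qmat_eq two_by_two_eq_iff algebra_simps)
  have "a = a'" "c = c'" "b = b'" "d = d'"
    using 1 2 by (auto simp: complex_eq_iff)
  then show ?thesis
    by (simp add: pq)
qed

end

section \<open>Holomorphic functions on a slice\<close>

text \<open>
  Multiplying by the slice of \<open>I\<close> on the left makes the quaternions a complex vector space; the
  derivative has to be complex linear, and so it is determined by its value \<open>p\<close> at \<open>1\<close>.
\<close>

definition slice_holomorphic_at :: "quat \<Rightarrow> (complex \<Rightarrow> quat) \<Rightarrow> complex \<Rightarrow> bool" where
  "slice_holomorphic_at I F z \<longleftrightarrow> (\<exists>p. (F has_derivative (\<lambda>w. slice_pt I w * p)) (at z))"

text \<open>
  Multiplying \<open>D 1 + I D \<i> = 0\<close> by \<open>I\<close> gives \<open>D \<i> = I D 1\<close>, so the real linear map \<open>D\<close> is complex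
  linear.
\<close>

lemma slice_regular_on_iff:
  "slice_regular_on \<Omega> f \<longleftrightarrow>
     (\<forall>I\<in>imag_units. \<forall>z. slice_pt I z \<in> \<Omega> \<longrightarrow> slice_holomorphic_at I (\<lambda>w. f (slice_pt I w)) z)"
proof -
  have "(\<exists>D. (F has_derivative D) (at z) \<and> (1/2) *\<^sub>R (D 1 + I * D \<i>) = 0) \<longleftrightarrow>
        slice_holomorphic_at I F z" if "I \<in> imag_units" for F I z
  proof
    assume "\<exists>D. (F has_derivative D) (at z) \<and> (1/2) *\<^sub>R (D 1 + I * D \<i>) = 0"
    then obtain D where D: "(F has_derivative D) (at z)" and CR: "D 1 + I * D \<i> = 0"
      by auto
    have "I * (D 1 + I * D \<i>) = 0"
      by (simp add: CR)
    then have Di: "D \<i> = I * D 1"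
      using imag_unit_square_left [OF that] by (simp add: distrib_left)
    have "D w = slice_pt I w * D 1" for w
    proof -
      have lin: "linear D"
        using D by (intro bounded_linear.linear has_derivative_bounded_linear)
      have "w = Re w *\<^sub>R 1 + Im w *\<^sub>R \<i>"
        by (simp add: complex_eq_iff)
      then have "D w = D (Re w *\<^sub>R 1 + Im w *\<^sub>R \<i>)"
        by (rule arg_cong)
      also have "\<dots> = Re w *\<^sub>R D 1 + Im w *\<^sub>R D \<i>"
        by (simp only: linear_add [OF lin] linear_scale [OF lin])
      finally show ?thesis
        by (simp add: Di slice_pt_scaleR algebra_simps)
    qed
    then have "D = (\<lambda>w. slice_pt I w * D 1)"
      by (rule ext)
    then have "(F has_derivative (\<lambda>w. slice_pt I w * D 1)) (at z)"
      by (rule subst) (rule D)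
    then show "slice_holomorphic_at I F z"
      by (auto simp: slice_holomorphic_at_def)
  next
    assume "slice_holomorphic_at I F z"
    then obtain p where "(F has_derivative (\<lambda>w. slice_pt I w * p)) (at z)"
      by (auto simp: slice_holomorphic_at_def)
    moreover have "slice_pt I 1 * p + I * (slice_pt I \<i> * p) = 0"
      by (simp add: imag_unit_square_left [OF that])
    ultimately show "\<exists>D. (F has_derivative D) (at z) \<and> (1/2) *\<^sub>R (D 1 + I * D \<i>) = 0"
      by (intro exI [of _ "\<lambda>w. slice_pt I w * p"]) simp
  qed
  then show ?thesis
    unfolding slice_regular_on_def by blast
qed

lemma slice_holomorphic_at_diff:
  assumes "slice_holomorphic_at I F z" "slice_holomorphic_at I G z"
  shows "slice_holomorphic_at I (\<lambda>w. F w - G w) z"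
proof -
  obtain p r where "(F has_derivative (\<lambda>w. slice_pt I w * p)) (at z)"
    "(G has_derivative (\<lambda>w. slice_pt I w * r)) (at z)"
    using assms by (auto simp: slice_holomorphic_at_def)
  then have "((\<lambda>w. F w - G w) has_derivative (\<lambda>w. slice_pt I w * p - slice_pt I w * r)) (at z)"
    by (rule has_derivative_diff)
  then show ?thesis
    unfolding slice_holomorphic_at_def by (auto simp flip: right_diff_distrib)
qed

lemma slice_holomorphic_at_transform:
  assumes "slice_holomorphic_at I F z" "open U" "z \<in> U" "\<And>w. w \<in> U \<Longrightarrow> F w = G w"
  shows "slice_holomorphic_at I G z"
  using assms has_derivative_transform_within_open unfolding slice_holomorphic_at_def by blast

text \<open>
  The complex linear functional with real part \<open>inner p\<close>, for the complex structure given by left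
  multiplication with \<open>I\<close>. These functionals separate points and reduce the study of
  quaternion-valued functions on a slice to that of holomorphic functions, without a choice of an
  imaginary unit orthogonal to \<open>I\<close>.
\<close>

definition slice_functional :: "quat \<Rightarrow> quat \<Rightarrow> quat \<Rightarrow> complex" where
  "slice_functional I p q = of_real (inner p q) - \<i> * of_real (inner p (I * q))"

lemma bounded_linear_slice_functional: "bounded_linear (slice_functional I p)"
  unfolding slice_functional_def [abs_def]
  by (intro bounded_linear_sub bounded_linear_const_mult bounded_linear_of_real [THEN bounded_linear_compose]
      bounded_linear_inner_right [THEN bounded_linear_compose] bounded_linear_mult_right bounded_linear_ident)

lemma slice_functional_mult:
  assumes "I \<in> imag_units"
  shows "slice_functional I p (slice_pt I w * q) = w * slice_functional I p q"
proof -
  have "slice_pt I w * q = Re w *\<^sub>R q + Im w *\<^sub>R (I * q)"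
    by (simp add: slice_pt_scaleR algebra_simps)
  then show ?thesis
    by (simp add: slice_functional_def distrib_left imag_unit_square_left [OF assms] inner_add_right
        complex_eq_iff algebra_simps)
qed

text \<open>
  After composition with the functionals above this is the classical identity theorem, as the real
  points of \<open>U\<close> accumulate at \<open>x\<close>.
\<close>

lemma slice_identity_principle:
  assumes I: "I \<in> imag_units"
    and U: "open U" "connected U" "of_real x \<in> U"
    and F: "\<And>z. z \<in> U \<Longrightarrow> slice_holomorphic_at I F z"
    and zero: "\<And>t. of_real t \<in> U \<Longrightarrow> F (of_real t) = 0"
    and z: "z \<in> U"
  shows "F z = 0"
proof -
  have *: "slice_functional I p (F z) = 0" for p
  proof (rule analytic_continuation [where f = "\<lambda>z. slice_functional I p (F z)" and w = z and U = "U \<inter> \<real>" and \<xi> = "of_real x"])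
    show "(\<lambda>z. slice_functional I p (F z)) holomorphic_on U"
    proof (rule holomorphic_onI)
      fix z assume "z \<in> U"
      then obtain q where "(F has_derivative (\<lambda>w. slice_pt I w * q)) (at z)"
        using F by (auto simp: slice_holomorphic_at_def)
      then have "((\<lambda>z. slice_functional I p (F z)) has_derivative
          (\<lambda>w. slice_functional I p (slice_pt I w * q))) (at z)"
        by (rule bounded_linear.has_derivative [OF bounded_linear_slice_functional])
      then have "((\<lambda>z. slice_functional I p (F z)) has_field_derivative slice_functional I p q) (at z)"
        unfolding has_field_derivative_def slice_functional_mult [OF I]
        by (rule has_derivative_eq_rhs) (simp add: fun_eq_iff mult.commute)
      then show "(\<lambda>z. slice_functional I p (F z)) field_differentiable at z within U"
        using field_differentiable_at_within field_differentiable_def by blast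
    qed
    show "of_real x islimpt U \<inter> \<real>"
      unfolding islimpt_approachable
    proof (intro allI impI)
      fix e :: real assume "0 < e"
      obtain r where r: "0 < r" "ball (of_real x) r \<subseteq> U"
        using U open_contains_ball by blast
      define t where "t = min e r / 2"
      have t: "0 < t" "t < e" "t < r"
        using \<open>0 < e\<close> r by (auto simp: t_def)
      have "dist (of_real (x + t)) (of_real x :: complex) = t"
        using t by (simp add: dist_norm)
      moreover from this have "of_real (x + t) \<in> U"
        using r t by (auto simp: dist_commute)
      ultimately show "\<exists>y\<in>U \<inter> \<real>. y \<noteq> of_real x \<and> dist y (of_real x) < e"
        using t by (intro bexI [of _ "of_real (x + t)"]) auto
    qed
    show "slice_functional I p (F w) = 0" if "w \<in> U \<inter> \<real>" for w
      using that zero by (auto elim!: Reals_cases simp: slice_functional_def)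
  qed (use U z in auto)
  have "inner (F z) (F z) = Re (slice_functional I (F z) (F z))"
    by (simp add: slice_functional_def)
  then show ?thesis
    by (simp add: *)
qed

section \<open>Stem functions\<close>

text \<open>
  The pair stands for \<open>F = F1 + \<i> F2\<close> with values in \<open>\<H> \<otimes> \<complex>\<close>; the last clause says that the
  derivative of \<open>F\<close> is \<open>w \<mapsto> w (p + \<i> r)\<close>.
\<close>

definition holomorphic_stem :: "complex set \<Rightarrow> (complex \<Rightarrow> quat) \<Rightarrow> (complex \<Rightarrow> quat) \<Rightarrow> bool" where
  "holomorphic_stem U F1 F2 \<longleftrightarrow> (\<forall>z\<in>U. F1 (cnj z) = F1 z \<and> F2 (cnj z) = - F2 z \<and>
     (\<exists>p r. (F1 has_derivative (\<lambda>w. Re w *\<^sub>R p - Im w *\<^sub>R r)) (at z) \<and>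
            (F2 has_derivative (\<lambda>w. Re w *\<^sub>R r + Im w *\<^sub>R p)) (at z)))"

text \<open>
  Substituting \<open>I\<close> for \<open>\<i>\<close> turns the derivative \<open>w \<mapsto> w (p + \<i> r)\<close> of the stem into left
  multiplication of \<open>p + I r\<close> by the point \<open>w\<close> of the slice.
\<close>

lemma holomorphic_stem_imp_slice_holomorphic_at:
  assumes I: "I \<in> imag_units" and "holomorphic_stem U F1 F2" "z \<in> U"
  shows "slice_holomorphic_at I (\<lambda>w. F1 w + I * F2 w) z"
proof -
  obtain p r where [derivative_intros]: "(F1 has_derivative (\<lambda>w. Re w *\<^sub>R p - Im w *\<^sub>R r)) (at z)"
    "(F2 has_derivative (\<lambda>w. Re w *\<^sub>R r + Im w *\<^sub>R p)) (at z)"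
    using assms(2,3) by (auto simp: holomorphic_stem_def)
  have "((\<lambda>w. F1 w + I * F2 w) has_derivative
      (\<lambda>w. Re w *\<^sub>R p - Im w *\<^sub>R r + I * (Re w *\<^sub>R r + Im w *\<^sub>R p))) (at z)"
    by (rule derivative_eq_intros refl)+ simp
  moreover have "Re w *\<^sub>R p - Im w *\<^sub>R r + I * (Re w *\<^sub>R r + Im w *\<^sub>R p) = slice_pt I w * (p + I * r)" for w
    by (simp add: slice_pt_scaleR algebra_simps imag_unit_square_left [OF I])
  ultimately show ?thesis
    by (auto simp: slice_holomorphic_at_def)
qed

text \<open>
  Multiplication of a stem by constant quaternions, on either side, is linear over \<open>\<complex>\<close>. For the left
  factor this fails on the level of slice regular functions, where pointwise left multiplication by
  \<open>b\<close> does not in general preserve regularity.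
\<close>

lemma holomorphic_stem_affine:
  assumes "holomorphic_stem U F1 F2"
  shows "holomorphic_stem U (\<lambda>z. b * (c + F1 z * d)) (\<lambda>z. b * (F2 z * d))"
  unfolding holomorphic_stem_def
proof (intro ballI conjI)
  fix z assume z: "z \<in> U"
  show "b * (c + F1 (cnj z) * d) = b * (c + F1 z * d)" "b * (F2 (cnj z) * d) = - (b * (F2 z * d))"
    using assms z by (simp_all add: holomorphic_stem_def)
  obtain p r where [derivative_intros]: "(F1 has_derivative (\<lambda>w. Re w *\<^sub>R p - Im w *\<^sub>R r)) (at z)"
    "(F2 has_derivative (\<lambda>w. Re w *\<^sub>R r + Im w *\<^sub>R p)) (at z)"
    using assms z by (auto simp: holomorphic_stem_def)
  show "\<exists>p r. ((\<lambda>z. b * (c + F1 z * d)) has_derivative (\<lambda>w. Re w *\<^sub>R p - Im w *\<^sub>R r)) (at z) \<and>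
      ((\<lambda>z. b * (F2 z * d)) has_derivative (\<lambda>w. Re w *\<^sub>R r + Im w *\<^sub>R p)) (at z)"
    by (rule exI [of _ "b * (p * d)"], rule exI [of _ "b * (r * d)"])
       (auto intro!: derivative_eq_intros simp: algebra_simps)
qed

text \<open>
  The point of the closed upper half plane that represents the sphere through \<open>q\<close>.
\<close>

definition coord :: "quat \<Rightarrow> complex" where
  "coord q = Complex (q0 q) (norm (q - of_real (q0 q)))"

text \<open>
  At real \<open>q\<close>, where no imaginary unit is distinguished, the value is \<open>0\<close>. This is harmless because
  an odd function vanishes at real points.
\<close>

definition unit_of :: "quat \<Rightarrow> quat" where
  "unit_of q = (q - of_real (q0 q)) /\<^sub>R norm (q - of_real (q0 q))"

definition induced :: "(complex \<Rightarrow> quat) \<Rightarrow> (complex \<Rightarrow> quat) \<Rightarrow> quat \<Rightarrow> quat" where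
  "induced F1 F2 q = F1 (coord q) + unit_of q * F2 (coord q)"

text \<open>
  A nonreal point is \<open>slice_pt I z\<close> in exactly two ways, related by \<open>(I, z) \<mapsto> (- I, cnj z)\<close>; the
  parity of the stem makes the two expressions agree.
\<close>

lemma induced_slice_pt:
  assumes I: "I \<in> imag_units" and F: "holomorphic_stem U F1 F2" and z: "z \<in> U"
  shows "induced F1 F2 (slice_pt I z) = F1 z + I * F2 z"
proof -
  have nI: "norm I = 1" and "q0 I = 0"
    using I by (simp_all add: imag_units_iff norm_eq_sqrt_inner)
  then have q: "q0 (slice_pt I z) = Re z" "slice_pt I z - of_real (Re z) = Im z *\<^sub>R I"
    by (simp_all add: slice_pt_scaleR of_real_def)
  then have c: "coord (slice_pt I z) = Complex (Re z) \<bar>Im z\<bar>"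
    and u: "unit_of (slice_pt I z) = sgn (Im z) *\<^sub>R I"
    by (simp_all add: coord_def unit_of_def nI sgn_real_def)
  have par: "F1 (cnj z) = F1 z" "F2 (cnj z) = - F2 z"
    using F z by (auto simp: holomorphic_stem_def)
  consider "Im z > 0" | "Im z < 0" | "Im z = 0" by linarith
  then show ?thesis
  proof cases
    case 1
    then show ?thesis
      by (simp add: induced_def c u sgn_real_def)
  next
    case 2
    then have "Complex (Re z) \<bar>Im z\<bar> = cnj z"
      by (simp add: complex_eq_iff)
    with 2 show ?thesis
      by (simp add: induced_def c u sgn_real_def par)
  next
    case 3
    then have "cnj z = z" "Complex (Re z) \<bar>Im z\<bar> = z"
      by (simp_all add: complex_eq_iff)
    with par have "F2 z = 0"
      by (simp add: eq_neg_iff_add_eq_0 flip: scaleR_2)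
    with 3 \<open>Complex (Re z) \<bar>Im z\<bar> = z\<close> show ?thesis
      by (simp add: induced_def c u)
  qed
qed

section \<open>Slice regular functions and their stems\<close>

locale slice_domain = anticommuting_units +
  fixes \<Omega> :: "quat set"
  assumes symmetric: "symmetric_slice_domain \<Omega>"
begin

text \<open>By symmetry every slice of \<open>\<Omega>\<close> is a copy of this set.\<close>

definition profile :: "complex set" where
  "profile = {z. slice_pt i z \<in> \<Omega>}"

lemma profile_iff: "I \<in> imag_units \<Longrightarrow> slice_pt I z \<in> \<Omega> \<longleftrightarrow> z \<in> profile"
  using symmetric i unfolding symmetric_slice_domain_def profile_def by blast

lemma cnj_profile_iff: "cnj z \<in> profile \<longleftrightarrow> z \<in> profile"
  using profile_iff [OF i, of "cnj z"] profile_iff [OF minus_imag_unit [OF i], of z]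
  by (simp add: slice_pt_cnj)

lemma open_profile: "open profile"
proof -
  have "open \<Omega>"
    using symmetric by (simp add: symmetric_slice_domain_def domain_in_def)
  then have "open (slice_pt i -` \<Omega>)"
    by (rule open_vimage) (rule continuous_slice_pt)
  then show ?thesis
    by (simp add: profile_def vimage_def)
qed

lemma connected_profile: "connected profile"
proof -
  have I: "inner 1 i = 0" "inner i 1 = 0" "inner i i = 1" "inner 1 (1::quat) = 1"
    using i by (auto simp: imag_units_iff) (simp_all add: inner_quat_def)
  have inv: "Complex (inner (slice_pt i z) 1) (inner (slice_pt i z) i) = z" for z
    by (simp add: slice_pt_scaleR inner_add_left I)
  have "connected (\<Omega> \<inter> range (slice_pt i))"
    using symmetric i by (auto simp: symmetric_slice_domain_def domain_in_def)
  moreover have "continuous_on (\<Omega> \<inter> range (slice_pt i)) (\<lambda>q. Complex (inner q 1) (inner q i))"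
    unfolding Complex_eq by (intro continuous_intros)
  ultimately have "connected ((\<lambda>q. Complex (inner q 1) (inner q i)) ` (\<Omega> \<inter> range (slice_pt i)))"
    by (intro connected_continuous_image)
  also have "(\<lambda>q. Complex (inner q 1) (inner q i)) ` (\<Omega> \<inter> range (slice_pt i)) = profile"
    by (force simp: profile_def inv image_iff)
  finally show ?thesis .
qed

lemma real_point_in_profile: obtains x :: real where "of_real x \<in> profile"
  using symmetric unfolding symmetric_slice_domain_def profile_def by auto

text \<open>
  The two parts of the stem are read off from the slice of \<open>i\<close>, where \<open>f (x + yi) = F1 + i F2\<close> and
  \<open>f (x - yi) = F1 - i F2\<close>.
\<close>

definition stem_re :: "(quat \<Rightarrow> quat) \<Rightarrow> complex \<Rightarrow> quat" where
  "stem_re f z = (1/2) *\<^sub>R (f (slice_pt i z) + f (slice_pt i (cnj z)))"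

definition stem_im :: "(quat \<Rightarrow> quat) \<Rightarrow> complex \<Rightarrow> quat" where
  "stem_im f z = - ((1/2) *\<^sub>R (i * (f (slice_pt i z) - f (slice_pt i (cnj z)))))"

lemma stem_recover: "stem_re f z + i * stem_im f z = f (slice_pt i z)"
  by (simp add: stem_re_def stem_im_def imag_unit_square_left [OF i] algebra_simps flip: scaleR_left.add)

lemma holomorphic_stem_of_regular:
  assumes "f \<in> SR \<Omega>"
  shows "holomorphic_stem profile (stem_re f) (stem_im f)"
  unfolding holomorphic_stem_def
proof (intro ballI conjI)
  fix z assume z: "z \<in> profile"
  show "stem_re f (cnj z) = stem_re f z" "stem_im f (cnj z) = - stem_im f z"
    by (simp_all add: stem_re_def stem_im_def algebra_simps)
  let ?F = "\<lambda>w. f (slice_pt i w)"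
  have hol: "slice_holomorphic_at i ?F w" if "w \<in> profile" for w
    using assms i that by (auto simp: SR_def slice_regular_on_iff profile_iff)
  obtain p where p: "(?F has_derivative (\<lambda>w. slice_pt i w * p)) (at z)"
    using hol [OF z] by (auto simp: slice_holomorphic_at_def)
  obtain p' where "(?F has_derivative (\<lambda>w. slice_pt i w * p')) (at (cnj z))"
    using hol [of "cnj z"] z by (auto simp: slice_holomorphic_at_def cnj_profile_iff)
  then have p': "((\<lambda>w. ?F (cnj w)) has_derivative (\<lambda>w. slice_pt i (cnj w) * p')) (at z)"
    by (rule has_derivative_compose [OF bounded_linear_imp_has_derivative [OF bounded_linear_cnj]])
  let ?P = "(1/2) *\<^sub>R (p + p')" and ?R = "- ((1/2) *\<^sub>R (i * (p - p')))"
  have 1: "(stem_re f has_derivative (\<lambda>w. (1/2) *\<^sub>R (slice_pt i w * p + slice_pt i (cnj w) * p'))) (at z)"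
    unfolding stem_re_def [abs_def] by (intro has_derivative_scaleR_right has_derivative_add p p')
  have 2: "(1/2) *\<^sub>R (slice_pt i w * p + slice_pt i (cnj w) * p') = Re w *\<^sub>R ?P - Im w *\<^sub>R ?R" for w
    by (simp add: slice_pt_scaleR algebra_simps)
  have 3: "(stem_im f has_derivative
      (\<lambda>w. - ((1/2) *\<^sub>R (i * (slice_pt i w * p - slice_pt i (cnj w) * p'))))) (at z)"
    unfolding stem_im_def [abs_def]
    by (intro has_derivative_minus has_derivative_scaleR_right has_derivative_mult_right has_derivative_diff p p')
  have 4: "- ((1/2) *\<^sub>R (i * (slice_pt i w * p - slice_pt i (cnj w) * p')))
      = Re w *\<^sub>R ?R + Im w *\<^sub>R ?P" for w
    by (simp add: slice_pt_scaleR algebra_simps imag_unit_square_left [OF i])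
  show "\<exists>p r. (stem_re f has_derivative (\<lambda>w. Re w *\<^sub>R p - Im w *\<^sub>R r)) (at z) \<and>
            (stem_im f has_derivative (\<lambda>w. Re w *\<^sub>R r + Im w *\<^sub>R p)) (at z)"
    using 1 3 unfolding 2 4 by blast
qed

text \<open>
  Both sides are holomorphic on the slice of \<open>I\<close>, and at real points they agree because there
  \<^const>\<open>stem_im\<close> vanishes.
\<close>

lemma representation_formula:
  assumes f: "f \<in> SR \<Omega>" and I: "I \<in> imag_units" and z: "z \<in> profile"
  shows "f (slice_pt I z) = stem_re f z + I * stem_im f z"
proof -
  obtain x :: real where x: "of_real x \<in> profile"
    by (rule real_point_in_profile)
  have "f (slice_pt I z) - (stem_re f z + I * stem_im f z) = 0"
  proof (rule slice_identity_principle [OF I open_profile connected_profile x _ _ z])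
    fix w assume "w \<in> profile"
    then show "slice_holomorphic_at I (\<lambda>z. f (slice_pt I z) - (stem_re f z + I * stem_im f z)) w"
      using f I holomorphic_stem_imp_slice_holomorphic_at [OF I holomorphic_stem_of_regular [OF f]]
      by (intro slice_holomorphic_at_diff) (auto simp: SR_def slice_regular_on_iff profile_iff)
  next
    fix t :: real
    show "f (slice_pt I (of_real t)) - (stem_re f (of_real t) + I * stem_im f (of_real t)) = 0"
      by (simp add: stem_re_def stem_im_def flip: scaleR_2)
  qed
  then show ?thesis by simp
qed

lemma regular_of_holomorphic_stem:
  assumes F: "holomorphic_stem profile F1 F2"
  obtains f where "f \<in> SR \<Omega>" "\<And>z. z \<in> profile \<Longrightarrow> stem_re f z = F1 z"
    "\<And>z. z \<in> profile \<Longrightarrow> stem_im f z = F2 z"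
proof
  define f where "f = restrict (induced F1 F2) \<Omega>"
  have f: "f (slice_pt I z) = F1 z + I * F2 z" if "I \<in> imag_units" "z \<in> profile" for I z
    using that by (simp add: f_def profile_iff induced_slice_pt [OF _ F])
  show "f \<in> SR \<Omega>"
    unfolding SR_def slice_regular_on_iff
  proof (intro CollectI conjI ballI allI impI)
    show "f \<in> extensional \<Omega>"
      by (simp add: f_def)
    fix I z assume I: "I \<in> imag_units" and "slice_pt I z \<in> \<Omega>"
    then have z: "z \<in> profile"
      by (simp add: profile_iff)
    show "slice_holomorphic_at I (\<lambda>w. f (slice_pt I w)) z"
      by (rule slice_holomorphic_at_transform [OF holomorphic_stem_imp_slice_holomorphic_at [OF I F z] open_profile z])
         (simp add: f [OF I])
  qed
  fix z assume z: "z \<in> profile"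
  have "F1 (cnj z) = F1 z" "F2 (cnj z) = - F2 z"
    using F z by (auto simp: holomorphic_stem_def)
  then show "stem_re f z = F1 z" "stem_im f z = F2 z"
    using z by (simp_all add: stem_re_def stem_im_def f [OF i] cnj_profile_iff imag_unit_square_left [OF i]
        algebra_simps flip: scaleR_left.add)
qed

text \<open>
  Parity carries the agreement to the lower half plane, and continuity to the real points, which are
  limits of nonreal ones. The representation formula then gives all other slices.
\<close>

lemma SR_eqI:
  assumes f: "f \<in> SR \<Omega>" and g: "g \<in> SR \<Omega>"
    and upper: "\<And>z. z \<in> profile \<Longrightarrow> Im z > 0 \<Longrightarrow> stem_re f z = stem_re g z \<and> stem_im f z = stem_im g z"
  shows "f = g"
proof -
  note f_stem = holomorphic_stem_of_regular [OF f] and g_stem = holomorphic_stem_of_regular [OF g]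
  have eq_half: "f (slice_pt i z) = g (slice_pt i z)" if z: "z \<in> profile" "Im z \<noteq> 0" for z
  proof -
    have "stem_re f z = stem_re g z \<and> stem_im f z = stem_im g z"
    proof (cases "Im z > 0")
      case True
      with upper z show ?thesis by blast
    next
      case False
      with z upper [of "cnj z"] have "stem_re f (cnj z) = stem_re g (cnj z)" "stem_im f (cnj z) = stem_im g (cnj z)"
        by (simp_all add: cnj_profile_iff)
      with f_stem g_stem z(1) show ?thesis
        by (simp add: holomorphic_stem_def)
    qed
    then show ?thesis
      by (metis stem_recover)
  qed
  have eq_i: "f (slice_pt i z) = g (slice_pt i z)" if z: "z \<in> profile" for z
  proof (cases "Im z = 0")
    case True
    let ?d = "\<lambda>w. f (slice_pt i w) - g (slice_pt i w)"
    let ?w = "\<lambda>n. z + \<i> * of_real (inverse (real (Suc n)))"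
    have "?w \<longlonglongrightarrow> z + \<i> * of_real 0"
      by (intro tendsto_intros LIMSEQ_inverse_real_of_nat)
    then have lim: "?w \<longlonglongrightarrow> z"
      by simp
    have "slice_holomorphic_at i ?d z"
      using f g i z by (intro slice_holomorphic_at_diff) (auto simp: SR_def slice_regular_on_iff profile_iff)
    then have "isCont ?d z"
      by (auto simp: slice_holomorphic_at_def dest: has_derivative_continuous)
    then have "(\<lambda>n. ?d (?w n)) \<longlonglongrightarrow> ?d z"
      using lim by (rule isCont_tendsto_compose)
    moreover have "\<forall>\<^sub>F n in sequentially. ?d (?w n) = 0"
      using topological_tendstoD [OF lim open_profile z]
    proof eventually_elim
      case (elim n)
      have "Im (?w n) \<noteq> 0"
        using True by simp
      with elim have "f (slice_pt i (?w n)) = g (slice_pt i (?w n))"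
        by (rule eq_half)
      then show ?case
        by (simp only: diff_self)
    qed
    then have "(\<lambda>n. ?d (?w n)) \<longlonglongrightarrow> 0"
      by (rule tendsto_eventually)
    ultimately show ?thesis
      using LIMSEQ_unique by fastforce
  qed (use z eq_half in blast)
  show ?thesis
  proof (rule extensionalityI)
    show "f \<in> extensional \<Omega>" "g \<in> extensional \<Omega>"
      using f g by (simp_all add: SR_def)
    fix q assume "q \<in> \<Omega>"
    obtain I z where "I \<in> imag_units" "q = slice_pt I z"
      using slice_pt_exhaust [OF i] by blast
    moreover from this \<open>q \<in> \<Omega>\<close> have "z \<in> profile"
      by (simp add: profile_iff)
    moreover from this have "stem_re f z = stem_re g z" "stem_im f z = stem_im g z"
      by (simp_all add: stem_re_def stem_im_def eq_i cnj_profile_iff)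
    ultimately show "f q = g q"
      by (simp add: representation_formula [OF f] representation_formula [OF g])
  qed
qed

section \<open>The twistor transform as the matrix of the stem\<close>

lemma upper_part_eq: "upper_part i \<Omega> = {z \<in> profile. Im z > 0}"
  by (auto simp: upper_part_def profile_def)

text \<open>
  The hat operation in the second column reads the value of \<open>f\<close> at the conjugate point, that is
  \<open>F1 - i F2\<close>. Conjugating the entries of this value gives the entries that \<^const>\<open>qmat\<close> prescribes
  for \<open>F1\<close>, plus \<open>\<i>\<close> times those for \<open>F2\<close>.
\<close>

lemma Phi_eq_complex_qmat: "Phi i j f z = complex_qmat (stem_re f z) (stem_im f z)"
proof -
  obtain a b c d where s: "stem_re f z = slice_pt i a + slice_pt i b * j"
    "stem_im f z = slice_pt i c + slice_pt i d * j"
    using quat_split_exists by metis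
  have "f (slice_pt i z) = slice_pt i (a + \<i> * c) + slice_pt i (b + \<i> * d) * j"
    unfolding stem_recover [of f z, symmetric] s by (simp add: slice_pt_mult [OF i] algebra_simps)
  then have 1: "split_g i j f z = a + \<i> * c" "split_h i j f z = b + \<i> * d"
    unfolding split_g_def split_h_def by (simp_all only: quat_split_eq fst_conv snd_conv)
  have parity: "stem_re f (cnj z) = stem_re f z" "stem_im f (cnj z) = - stem_im f z"
    by (simp_all add: stem_re_def stem_im_def algebra_simps)
  have "f (slice_pt i (cnj z)) = slice_pt i (a - \<i> * c) + slice_pt i (b - \<i> * d) * j"
    unfolding stem_recover [of f "cnj z", symmetric] parity s
    by (simp add: slice_pt_mult [OF i] algebra_simps)
  then have 2: "split_g i j f (cnj z) = a - \<i> * c" "split_h i j f (cnj z) = b - \<i> * d"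
    unfolding split_g_def split_h_def by (simp_all only: quat_split_eq fst_conv snd_conv)
  show ?thesis
    by (simp add: Phi_def hat_def 1 2 s complex_qmat_eq)
qed

lemma twistor_transform_inject:
  assumes "f \<in> SR \<Omega>" "g \<in> SR \<Omega>" "twistor_transform i j \<Omega> f = twistor_transform i j \<Omega> g"
  shows "f = g"
proof (rule SR_eqI [OF assms(1,2)])
  fix z assume "z \<in> profile" "Im z > 0"
  then have "graph_space (Phi i j f z) = graph_space (Phi i j g z)"
    using fun_cong [OF assms(3), of z] by (simp add: twistor_transform_def upper_part_eq)
  then show "stem_re f z = stem_re g z \<and> stem_im f z = stem_im g z"
    by (simp add: graph_space_eq_iff Phi_eq_complex_qmat complex_qmat_inject)
qed

section \<open>The action\<close>

text \<open>
  Write the blocks as \<open>A = qmat a\<close>, \<open>C = qmat c\<close>, \<open>D = qmat d\<close>. Because \<^const>\<open>qmat\<close> reverses products,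
  the equation \<open>\<Phi> A = C + D \<Phi>\<^sub>f\<close> is solved by the stem \<open>a\<^sup>-\<^sup>1 (c + F1 d)\<close>, \<open>a\<^sup>-\<^sup>1 F2 d\<close>.
\<close>

lemma pullback_exists:
  assumes T: "T \<in> B_H" and f: "f \<in> SR \<Omega>"
  shows "\<exists>F\<in>SR \<Omega>. twistor_transform i j \<Omega> F =
    (\<lambda>v\<in>upper_part i \<Omega>. (\<lambda>x. T *v x) ` twistor_transform i j \<Omega> f v)"
proof -
  obtain A C D where "A \<in> quat_blocks" "C \<in> quat_blocks" "D \<in> quat_blocks"
    and T_eq: "T = block_matrix A 0 C D" and "invertible T"
    using T by (auto simp: B_H_iff)
  then obtain a c d where acd: "A = qmat a" "C = qmat c" "D = qmat d"
    unfolding range_qmat [symmetric] by blast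
  have A: "invertible A"
    using \<open>invertible T\<close> invertible_upper_left_block T_eq by blast
  have "a \<noteq> 0"
  proof
    assume "a = 0"
    then have "A + A = A"
      by (simp add: acd flip: qmat_add)
    then have "A = 0" by simp
    with A show False
      by (auto simp: invertible_def two_by_two_eq_iff mat_def)
  qed
  obtain F where F: "F \<in> SR \<Omega>"
    and F_stem: "\<And>z. z \<in> profile \<Longrightarrow> stem_re F z = inverse a * (c + stem_re f z * d)"
      "\<And>z. z \<in> profile \<Longrightarrow> stem_im F z = inverse a * (stem_im f z * d)"
    using regular_of_holomorphic_stem [OF holomorphic_stem_affine [OF holomorphic_stem_of_regular [OF f]]]
    by blast
  have "(*v) T ` graph_space (Phi i j f z) = graph_space (Phi i j F z)" if z: "z \<in> profile" for z
    unfolding T_eq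
  proof (rule image_graph_space [OF _ A])
    have "qmat (stem_re F z) ** A = qmat (a * stem_re F z)"
      by (simp add: acd qmat_mult)
    also have "a * stem_re F z = c + stem_re f z * d"
      using \<open>a \<noteq> 0\<close> by (simp add: F_stem z flip: mult.assoc)
    finally have re: "qmat (stem_re F z) ** A = C + D ** qmat (stem_re f z)"
      by (simp add: acd qmat_mult qmat_add)
    have "qmat (stem_im F z) ** A = qmat (a * stem_im F z)"
      by (simp add: acd qmat_mult)
    also have "a * stem_im F z = stem_im f z * d"
      using \<open>a \<noteq> 0\<close> by (simp add: F_stem z flip: mult.assoc)
    finally have im: "qmat (stem_im F z) ** A = D ** qmat (stem_im f z)"
      by (simp add: acd qmat_mult)
    have "Phi i j F z ** A = qmat (stem_re F z) ** A + mat \<i> ** (qmat (stem_im F z) ** A)"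
      by (simp add: Phi_eq_complex_qmat complex_qmat_def matrix_add_rdistrib matrix_mul_assoc)
    also have "\<dots> = C + (D ** qmat (stem_re f z) + (mat \<i> ** D) ** qmat (stem_im f z))"
      by (simp add: re im add.assoc matrix_mul_assoc)
    also have "\<dots> = C + D ** Phi i j f z"
      by (simp add: Phi_eq_complex_qmat complex_qmat_def mat_commutes [of \<i> D] matrix_add_ldistrib matrix_mul_assoc)
    finally show "Phi i j F z ** A = C + D ** Phi i j f z" .
  qed
  then show ?thesis
    by (intro bexI [OF _ F]) (auto simp: twistor_transform_def upper_part_eq fun_eq_iff restrict_def)
qed

lemma pullback:
  assumes "T \<in> B_H" and "f \<in> SR \<Omega>"
  shows "pullback i j \<Omega> T f \<in> SR \<Omega>"
    and "twistor_transform i j \<Omega> (pullback i j \<Omega> T f) =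
      (\<lambda>v\<in>upper_part i \<Omega>. (\<lambda>x. T *v x) ` twistor_transform i j \<Omega> f v)"
proof -
  have "\<exists>!F. F \<in> SR \<Omega> \<and> twistor_transform i j \<Omega> F =
      (\<lambda>v\<in>upper_part i \<Omega>. (\<lambda>x. T *v x) ` twistor_transform i j \<Omega> f v)"
    using pullback_exists [OF assms] by (metis twistor_transform_inject)
  then have "pullback i j \<Omega> T f \<in> SR \<Omega> \<and> twistor_transform i j \<Omega> (pullback i j \<Omega> T f) =
      (\<lambda>v\<in>upper_part i \<Omega>. (\<lambda>x. T *v x) ` twistor_transform i j \<Omega> f v)"
    unfolding pullback_def by (rule theI')
  then show "pullback i j \<Omega> T f \<in> SR \<Omega>"
    and "twistor_transform i j \<Omega> (pullback i j \<Omega> T f) =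
      (\<lambda>v\<in>upper_part i \<Omega>. (\<lambda>x. T *v x) ` twistor_transform i j \<Omega> f v)"
    by auto
qed

lemma pullback_eqI:
  assumes "T \<in> B_H" "f \<in> SR \<Omega>" "F \<in> SR \<Omega>"
    and "\<And>v. v \<in> upper_part i \<Omega> \<Longrightarrow>
      twistor_transform i j \<Omega> F v = (\<lambda>x. T *v x) ` twistor_transform i j \<Omega> f v"
  shows "pullback i j \<Omega> T f = F"
proof (rule twistor_transform_inject [OF pullback(1) [OF assms(1,2)] assms(3)])
  show "twistor_transform i j \<Omega> (pullback i j \<Omega> T f) = twistor_transform i j \<Omega> F"
    unfolding pullback(2) [OF assms(1,2)]
    using assms(4) by (auto simp: fun_eq_iff) (simp_all add: twistor_transform_def)
qed

lemma pullback_one: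
  assumes "f \<in> SR \<Omega>"
  shows "pullback i j \<Omega> (mat 1) f = f"
  using subgroup.one_closed [OF subgroup_B_H] assms by (intro pullback_eqI) simp_all

lemma pullback_mult:
  assumes S: "S \<in> B_H" and T: "T \<in> B_H" and f: "f \<in> SR \<Omega>"
  shows "pullback i j \<Omega> (S ** T) f = pullback i j \<Omega> S (pullback i j \<Omega> T f)"
proof (rule pullback_eqI)
  show "S ** T \<in> B_H"
    using subgroup.m_closed [OF subgroup_B_H S T] by simp
  show "pullback i j \<Omega> S (pullback i j \<Omega> T f) \<in> SR \<Omega>"
    using assms by (intro pullback)
  show "twistor_transform i j \<Omega> (pullback i j \<Omega> S (pullback i j \<Omega> T f)) v =
      (\<lambda>x. (S ** T) *v x) ` twistor_transform i j \<Omega> f v" if "v \<in> upper_part i \<Omega>" for v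
    using that assms by (simp add: pullback image_image matrix_vector_mul_assoc)
qed (rule f)

lemma pullback_proj_class:
  assumes T: "T \<in> B_H" and S: "S \<in> proj_class T" and f: "f \<in> SR \<Omega>"
  shows "pullback i j \<Omega> S f = pullback i j \<Omega> T f"
proof -
  obtain r :: real where r: "r \<noteq> 0" "S = mat (of_real r) ** T"
    using S by (auto simp: mem_proj_class_iff)
  have B: "mat (of_real r) \<in> B_H"
    using r real_scalars_subset_B_H by (auto simp: real_scalars_def)
  have "pullback i j \<Omega> (mat (of_real r)) F = F" if "F \<in> SR \<Omega>" for F
    using B that r(1) by (intro pullback_eqI) (simp_all add: twistor_transform_def scalar_image_graph_space)
  then show ?thesis
    by (simp add: r(2) pullback_mult [OF B T f] pullback [OF T f])
qed

lemma class_pullback: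
  assumes "T \<in> B_H" and "f \<in> SR \<Omega>"
  shows "class_pullback i j \<Omega> (proj_class T) f = pullback i j \<Omega> T f"
proof -
  have "(\<lambda>S. pullback i j \<Omega> S f) ` proj_class T = (\<lambda>S. pullback i j \<Omega> T f) ` proj_class T"
    by (intro image_cong refl pullback_proj_class assms)
  also have "\<dots> = {pullback i j \<Omega> T f}"
    by (rule image_constant [OF proj_class_self])
  finally have "(\<lambda>S. pullback i j \<Omega> S f) ` proj_class T = {pullback i j \<Omega> T f}" .
  then show ?thesis
    by (simp add: class_pullback_def)
qed

text \<open>
  Constants are the test functions for faithfulness: their matrices are all the quaternionic blocks.
\<close>

lemma const_regular: "(\<lambda>q\<in>\<Omega>. c) \<in> SR \<Omega>"
  unfolding SR_def slice_regular_on_iff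
proof (intro CollectI conjI ballI allI impI)
  fix I z assume I: "I \<in> imag_units" and "slice_pt I z \<in> \<Omega>"
  then have z: "z \<in> profile"
    by (simp add: profile_iff)
  have "slice_holomorphic_at I (\<lambda>_. c) z"
    unfolding slice_holomorphic_at_def by (rule exI [of _ 0]) simp
  then show "slice_holomorphic_at I (\<lambda>w. (\<lambda>q\<in>\<Omega>. c) (slice_pt I w)) z"
    by (rule slice_holomorphic_at_transform [OF _ open_profile z]) (simp add: profile_iff [OF I])
qed simp

lemma Phi_const:
  assumes "z \<in> profile"
  shows "Phi i j (\<lambda>q\<in>\<Omega>. c) z = qmat c"
proof -
  have "stem_re (\<lambda>q\<in>\<Omega>. c) z = c" "stem_im (\<lambda>q\<in>\<Omega>. c) z = 0"
    using assms by (simp_all add: stem_re_def stem_im_def profile_iff [OF i] cnj_profile_iff flip: scaleR_2)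
  moreover have "qmat 0 = 0"
    using qmat_add [of 0 0] by simp
  ultimately show ?thesis
    by (simp add: Phi_eq_complex_qmat complex_qmat_def)
qed

text \<open>Faithfulness needs a point at which the graphs of two matrices can be compared.\<close>

lemma upper_part_nonempty: "upper_part i \<Omega> \<noteq> {}"
proof -
  obtain x :: real where "of_real x \<in> profile"
    by (rule real_point_in_profile)
  then obtain r where r: "0 < r" "ball (of_real x) r \<subseteq> profile"
    using open_profile open_contains_ball by blast
  have "of_real x + \<i> * of_real (r/2) \<in> profile"
    using r by (intro subsetD [OF r(2)]) (simp add: dist_norm norm_mult)
  then have "of_real x + \<i> * of_real (r/2) \<in> upper_part i \<Omega>"
    using r by (simp add: upper_part_eq)
  then show ?thesis by blast
qed

lemma pullback_faithful:
  assumes T: "T \<in> B_H" and trivial: "\<And>f. f \<in> SR \<Omega> \<Longrightarrow> pullback i j \<Omega> T f = f"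
  shows "T \<in> real_scalars"
proof (rule graph_fixing_is_real_scalar [OF T])
  fix M assume "M \<in> quat_blocks"
  then obtain c where M: "M = qmat c"
    unfolding range_qmat [symmetric] by blast
  obtain v where v: "v \<in> upper_part i \<Omega>"
    using upper_part_nonempty by blast
  let ?f = "\<lambda>q\<in>\<Omega>. c"
  have "twistor_transform i j \<Omega> ?f v = (*v) T ` twistor_transform i j \<Omega> ?f v"
    using fun_cong [OF pullback(2) [OF T const_regular, of c], of v] v
    by (simp only: trivial [OF const_regular] restrict_apply')
  moreover have "twistor_transform i j \<Omega> ?f v = graph_space M"
    using v Phi_const [of v c] by (simp add: twistor_transform_def M upper_part_eq)
  ultimately show "(*v) T ` graph_space M = graph_space M"
    by simp
qed

lemma restricted_pullback_Bij:
  assumes T: "T \<in> B_H"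
  shows "(\<lambda>f\<in>SR \<Omega>. pullback i j \<Omega> T f) \<in> Bij (SR \<Omega>)"
proof -
  let ?S = "inv\<^bsub>GL2H\<^esub> T"
  have TG: "T \<in> carrier GL2H"
    using T subgroup.mem_carrier [OF subgroup_B_H] by blast
  have S: "?S \<in> B_H"
    using T by (rule subgroup.m_inv_closed [OF subgroup_B_H])
  have inv: "T ** ?S = mat 1" "?S ** T = mat 1"
    using group.r_inv [OF group_GL2H TG] group.l_inv [OF group_GL2H TG] by simp_all
  have "bij_betw (\<lambda>f\<in>SR \<Omega>. pullback i j \<Omega> T f) (SR \<Omega>) (SR \<Omega>)"
  proof (rule bij_betw_byWitness [where f' = "pullback i j \<Omega> ?S"])
    show "\<forall>f\<in>SR \<Omega>. pullback i j \<Omega> ?S ((\<lambda>f\<in>SR \<Omega>. pullback i j \<Omega> T f) f) = f"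
      by (simp add: inv pullback_one flip: pullback_mult [OF S T])
    show "\<forall>f\<in>SR \<Omega>. (\<lambda>f\<in>SR \<Omega>. pullback i j \<Omega> T f) (pullback i j \<Omega> ?S f) = f"
      by (simp add: inv pullback_one pullback [OF S] flip: pullback_mult [OF T S])
  qed (use pullback(1) [OF T] pullback(1) [OF S] in auto)
  then show ?thesis
    by (simp add: Bij_def)
qed

lemma restrict_class_pullback:
  "T \<in> B_H \<Longrightarrow> (\<lambda>f\<in>SR \<Omega>. class_pullback i j \<Omega> (proj_class T) f) = (\<lambda>f\<in>SR \<Omega>. pullback i j \<Omega> T f)"
  by (auto simp: class_pullback)

text \<open>
  The homomorphism property is \<open>(S T)\<^sup>* = S\<^sup>* T\<^sup>*\<close>. If \<open>S\<close> and \<open>T\<close> act in the same way, then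
  \<open>T\<^sup>-\<^sup>1 S\<close> acts trivially, so it is a real scalar.
\<close>

lemma faithful_class_pullback:
  "faithful_action Gamma_univ (SR \<Omega>) (\<lambda>X. \<lambda>f\<in>SR \<Omega>. class_pullback i j \<Omega> X f)"
proof -
  let ?\<phi> = "\<lambda>X. \<lambda>f\<in>SR \<Omega>. class_pullback i j \<Omega> X f"
  interpret proj: group_hom GL2H PGL2H proj_class
    by (rule group_hom_proj_class)
  note mem = subgroup.mem_carrier [OF subgroup_B_H]
  have grp: "group Gamma_univ"
    unfolding Gamma_univ_def
    by (intro subgroup.subgroup_is_group proj.subgroup_img_is_subgroup subgroup_B_H proj.H.is_group)
  have hom: "?\<phi> \<in> hom Gamma_univ (BijGroup (SR \<Omega>))"
  proof (rule homI)
    fix X assume "X \<in> carrier Gamma_univ"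
    then show "?\<phi> X \<in> carrier (BijGroup (SR \<Omega>))"
      by (auto simp: Gamma_univ_def BijGroup_def restrict_class_pullback intro: restricted_pullback_Bij)
  next
    fix X Y assume "X \<in> carrier Gamma_univ" "Y \<in> carrier Gamma_univ"
    then obtain S T where S: "S \<in> B_H" "X = proj_class S" and T: "T \<in> B_H" "Y = proj_class T"
      by (auto simp: Gamma_univ_def)
    have ST: "S ** T \<in> B_H"
      using subgroup.m_closed [OF subgroup_B_H S(1) T(1)] by simp
    have "X \<otimes>\<^bsub>Gamma_univ\<^esub> Y = proj_class (S ** T)"
      using proj.hom_mult [OF mem [OF S(1)] mem [OF T(1)]] by (simp add: Gamma_univ_def S T)
    moreover have "(\<lambda>f\<in>SR \<Omega>. pullback i j \<Omega> (S ** T) f) =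
        compose (SR \<Omega>) (\<lambda>f\<in>SR \<Omega>. pullback i j \<Omega> S f) (\<lambda>f\<in>SR \<Omega>. pullback i j \<Omega> T f)"
      using pullback_mult [OF S(1) T(1)] pullback(1) [OF T(1)] by (auto simp: compose_def)
    ultimately show "?\<phi> (X \<otimes>\<^bsub>Gamma_univ\<^esub> Y) = ?\<phi> X \<otimes>\<^bsub>BijGroup (SR \<Omega>)\<^esub> ?\<phi> Y"
      by (simp only: S(2) T(2) restrict_class_pullback [OF S(1)] restrict_class_pullback [OF T(1)]
          restrict_class_pullback [OF ST])
         (simp add: BijGroup_def restricted_pullback_Bij S T)
  qed
  have "group_action Gamma_univ (SR \<Omega>) ?\<phi>"
    using grp hom group_BijGroup by (simp add: group_action_def group_hom_def group_hom_axioms_def)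
  moreover have "inj_on ?\<phi> (carrier Gamma_univ)"
  proof (rule inj_onI)
    fix X Y assume "X \<in> carrier Gamma_univ" "Y \<in> carrier Gamma_univ" and eq: "?\<phi> X = ?\<phi> Y"
    then obtain S T where S: "S \<in> B_H" "X = proj_class S" and T: "T \<in> B_H" "Y = proj_class T"
      by (auto simp: Gamma_univ_def)
    have same: "pullback i j \<Omega> S f = pullback i j \<Omega> T f" if "f \<in> SR \<Omega>" for f
      using fun_cong [OF eq, of f] that by (simp add: S T class_pullback)
    let ?T' = "inv\<^bsub>GL2H\<^esub> T"
    have T': "?T' \<in> B_H"
      using T(1) by (rule subgroup.m_inv_closed [OF subgroup_B_H])
    have inv: "T ** ?T' = mat 1" "?T' ** T = mat 1"
      using proj.G.r_inv [OF mem [OF T(1)]] proj.G.l_inv [OF mem [OF T(1)]] by simp_all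
    have "?T' ** S \<in> real_scalars"
    proof (rule pullback_faithful)
      show "?T' ** S \<in> B_H"
        using subgroup.m_closed [OF subgroup_B_H T' S(1)] by simp
      show "pullback i j \<Omega> (?T' ** S) f = f" if "f \<in> SR \<Omega>" for f
        using that by (simp add: pullback_mult [OF T' S(1)] same inv pullback_one flip: pullback_mult [OF T' T(1)])
    qed
    then obtain r :: real where r: "r \<noteq> 0" "?T' ** S = mat (of_real r)"
      by (auto simp: real_scalars_def)
    have "S = T ** (?T' ** S)"
      by (simp add: matrix_mul_assoc inv)
    also have "\<dots> = mat (of_real r) ** T"
      by (simp add: r(2) mat_commutes [of _ T])
    finally have "S \<in> proj_class T"
      using r(1) by (auto simp: mem_proj_class_iff)
    then show "X = Y"
      unfolding S(2) T(2) proj_class_def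
      using proj.G.repr_independence [OF _ mem [OF T(1)]] normal_real_scalars
      by (metis normal_def)
  qed
  ultimately show ?thesis
    by (simp add: faithful_action_def faithful_action_axioms_def)
qed

end

theorem theorem5p16:
  fixes \<Omega> :: "quat set" and i j :: quat
  assumes "i \<in> imag_units" and "j \<in> imag_units" and "i * j = - (j * i)"
    and "symmetric_slice_domain \<Omega>"
  shows "(\<forall>T\<in>B_H. \<forall>T'\<in>B_H. proj_class T = proj_class T' \<longrightarrow>
            (\<forall>f\<in>SR \<Omega>. pullback i j \<Omega> T f = pullback i j \<Omega> T' f)) \<and>
         (\<forall>T\<in>B_H. \<forall>f\<in>SR \<Omega>. class_pullback i j \<Omega> (proj_class T) f = pullback i j \<Omega> T f) \<and>
         faithful_action Gamma_univ (SR \<Omega>) (\<lambda>X. \<lambda>f\<in>SR \<Omega>. class_pullback i j \<Omega> X f)"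
proof -
  interpret slice_domain i j \<Omega>
    using assms by unfold_locales
  show ?thesis
    using class_pullback faithful_class_pullback by metis
qed

end
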